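(* Let $\varepsilon_0=1$ and, for $0\le\varepsilon<\varepsilon_0$, let $$C(\varepsilon)=\frac{e^{-\varepsilon}}{1-\varepsilon}.$$ Then for every bounded interval $I$, every $0\le\varepsilon<\varepsilon_0$ and every $\varphi\in \mathrm{BMO}_{\varepsilon}(I)$, $$\langle e^\varphi\rangle_I\le C(\varepsilon)\,e^{\langle\varphi\rangle_I}.$$ Moreover, $\varepsilon_0$ and $C(\varepsilon)$ are sharp: $\varepsilon_0=1$ is the largest number such that for every $0\le\varepsilon<\varepsilon_0$ there is a finite constant $C$ with $\langle e^\varphi\rangle_I\le C e^{\langle\varphi\rangle_I}$ for all $\varphi\in\mathrm{BMO}_\varepsilon(I)$; and for each $0\le\varepsilon<1$, $C(\varepsilon)$ is the smallest constant for which this inequality holds for all $\varphi\in\mathrm{BMO}_\varepsilon(I)$.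
   Context: For a bounded interval $J\subset\mathbb{R}$ of positive length, $\langle\varphi\rangle_J=\frac1{|J|}\int_J\varphi$. For an interval $I$, $\mathrm{BMO}(I)$ is the set of real-valued $\varphi\in L^1(I)$ with $$\|\varphi\|_{\mathrm{BMO}(I)}=\Bigl(\sup_{J\subset I}\bigl\{\langle\varphi^2\rangle_J-\langle\varphi\rangle_J^2\bigr\}\Bigr)^{1/2}<\infty,$$ the supremum being over all subintervals $J$ of $I$ (this is the $L^2$-based BMO: $\langle\varphi^2\rangle_J-\langle\varphi\rangle_J^2=\langle|\varphi-\langle\varphi\rangle_J|^2\rangle_J$). For $\varepsilon\ge0$, $\mathrm{BMO}_\varepsilon(I)=\{\varphi\in\mathrm{BMO}(I):\|\varphi\|_{\mathrm{BMO}(I)}\le\varepsilon\}$. *)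

theory Defs
  imports "HOL-Analysis.Analysis"
begin

definition bounded_interval :: "real set \<Rightarrow> bool" where
  "bounded_interval J \<longleftrightarrow> is_interval J \<and> bounded J \<and> 0 < measure lebesgue J"

definition avg :: "real set \<Rightarrow> (real \<Rightarrow> real) \<Rightarrow> real" where
  "avg J f = (LINT x:J|lebesgue. f x) / measure lebesgue J"

text \<open>The average of a nonnegative function, with value \<open>\<infinity>\<close> if the function is not
  integrable over \<open>J\<close> (the Bochner integral in \<^const>\<open>avg\<close> would be \<open>0\<close> in this case).
  To be used for nonnegative functions only: negative values are cut off at \<open>0\<close>.\<close>

definition ext_avg :: "real set \<Rightarrow> (real \<Rightarrow> real) \<Rightarrow> ereal" where
  "ext_avg J f = enn2ereal ((\<integral>\<^sup>+x\<in>J. ennreal (f x) \<partial>lebesgue) / emeasure lebesgue J)"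

definition BMO_sup :: "real set \<Rightarrow> (real \<Rightarrow> real) \<Rightarrow> ereal" where
  "BMO_sup I \<phi> =
    (SUP J \<in> {J. bounded_interval J \<and> J \<subseteq> I}. ext_avg J (\<lambda>x. (\<phi> x)\<^sup>2) - ereal ((avg J \<phi>)\<^sup>2))"

definition BMO :: "real set \<Rightarrow> (real \<Rightarrow> real) set" where
  "BMO I = {\<phi>. set_integrable lebesgue I \<phi> \<and> BMO_sup I \<phi> < \<infinity>}"

text \<open>The following value is meaningful only for functions in \<^term>\<open>BMO I\<close>.\<close>

definition BMO_norm :: "real set \<Rightarrow> (real \<Rightarrow> real) \<Rightarrow> real" where
  "BMO_norm I \<phi> = sqrt (real_of_ereal (BMO_sup I \<phi>))"

definition BMO_eps :: "real \<Rightarrow> real set \<Rightarrow> (real \<Rightarrow> real) set" where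
  "BMO_eps \<epsilon> I = {\<phi> \<in> BMO I. BMO_norm I \<phi> \<le> \<epsilon>}"

definition JN_const :: "real \<Rightarrow> real" where
  "JN_const \<epsilon> = exp (- \<epsilon>) / (1 - \<epsilon>)"

definition integral_JN :: "real set \<Rightarrow> real \<Rightarrow> real \<Rightarrow> bool" where
  "integral_JN I \<epsilon> C \<longleftrightarrow>
    (\<forall>\<phi> \<in> BMO_eps \<epsilon> I. ext_avg I (\<lambda>x. exp (\<phi> x)) \<le> ereal (C * exp (avg I \<phi>)))"

end

theory Submission
  imports Defs "HOL-Real_Asymp.Real_Asymp"
begin

text \<open>
  Let \<open>x(J) = (\<langle>\<phi>\<rangle>\<^sub>J, \<langle>\<phi>\<^sup>2\<rangle>\<^sub>J)\<close>; for \<open>\<phi>\<close> in \<open>BMO\<^sub>\<epsilon>\<close> these points lie in the strip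
  \<open>x\<^sub>1\<^sup>2 \<le> x\<^sub>2 \<le> x\<^sub>1\<^sup>2 + \<epsilon>\<^sup>2\<close>.  For \<open>\<epsilon> < \<delta> < 1\<close> the Bellman function
  \<open>B = (1 - r) exp (x\<^sub>1 + r - \<delta>) / (1 - \<delta>)\<close>, \<open>r = sqrt (\<delta>\<^sup>2 - (x\<^sub>2 - x\<^sub>1\<^sup>2))\<close>, is concave
  along every segment of the wider strip of parameter \<open>\<delta>\<close>.  Each interval \<open>J\<close> can be cut, in a ratio
  bounded away from \<open>0\<close> and \<open>1\<close>, into \<open>J\<^sub>-\<close> and \<open>J\<^sub>+\<close> such that the segment from \<open>x(J\<^sub>-)\<close> to \<open>x(J\<^sub>+)\<close> stays in
  the wider strip.  Iterating the cut reduces \<open>\<langle>e\<^sup>\<phi>\<rangle>\<^sub>I \<le> B (x(I))\<close>, for bounded \<open>\<phi>\<close>, to short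
  intervals, where it holds up to an arbitrarily small additive error because \<open>\<phi>\<close> is close in \<open>L\<^sup>1\<close>
  to a continuous function.  Truncation removes the boundedness, and \<open>\<delta> \<rightarrow> \<epsilon>\<close> gives the constant.
  Sharpness is witnessed on an interval with endpoints \<open>a < b\<close> by
  \<open>\<phi>(t) = - \<epsilon> ln ((t - a) / (b - a))\<close>, which attains equality.
\<close>

section \<open>The Bellman function\<close>

text \<open>The difference quotient of an indefinite integral is the average of the integrand.\<close>

definition dq :: "(real \<Rightarrow> real) \<Rightarrow> real \<Rightarrow> real \<Rightarrow> real" where
  "dq F c d = (F d - F c) / (d - c)"

text \<open>For 0 \<le> \<delta> < 1 it equals \<open>exp x\<close> on the lower parabola y = x^2 of
  the strip and \<open>JN_const \<delta> * exp x\<close> on the upper parabola y = x^2 +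
  \<delta>^2.\<close>

definition bell :: "real \<Rightarrow> real \<Rightarrow> real \<Rightarrow> real" where
  "bell \<delta> x y = (1 - sqrt (\<delta>\<^sup>2 - (y - x\<^sup>2))) * exp (x + sqrt (\<delta>\<^sup>2 - (y - x\<^sup>2)) - \<delta>) / (1 - \<delta>)"

text \<open>The derivative of \<open>(1 - s) * exp s\<close> is \<open>- s * exp s\<close>. For
  fixed x, \<open>bell\<close> is a multiple of this function of its square root, so it is monotone
  between the two parabolas.\<close>

lemma one_minus_mult_exp_antimono:
  fixes r s :: real
  assumes "0 \<le> r" "r \<le> s"
  shows "(1 - s) * exp s \<le> (1 - r) * exp r"
proof (rule DERIV_nonpos_imp_nonincreasing[OF assms(2)])
  fix x :: real assume "r \<le> x" "x \<le> s"
  then show "\<exists>y. ((\<lambda>s. (1 - s) * exp s) has_real_derivative y) (at x) \<and> y \<le> 0"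
    using assms by (intro exI[of _ "- x * exp x"]) (auto intro!: derivative_eq_intros simp: algebra_simps)
qed

text \<open>Both bounds are boundary values of \<open>bell\<close>. The lower one settles short
  intervals, the upper one produces the constant.\<close>

lemma bell_bounds:
  assumes "0 \<le> \<delta>" "\<delta> < 1" "x\<^sup>2 \<le> y" "y - x\<^sup>2 \<le> \<delta>\<^sup>2"
  shows "exp x \<le> bell \<delta> x y" "bell \<delta> x y \<le> JN_const \<delta> * exp x"
proof -
  define r where "r = sqrt (\<delta>\<^sup>2 - (y - x\<^sup>2))"
  have r: "0 \<le> r" "r \<le> \<delta>"
    using assms by (auto simp: r_def intro!: real_le_lsqrt)
  have B: "bell \<delta> x y = ((1 - r) * exp r) * (exp x * exp (- \<delta>) / (1 - \<delta>))"
    by (simp add: bell_def r_def exp_add exp_diff exp_minus field_simps)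
  have pos: "0 \<le> exp x * exp (- \<delta>) / (1 - \<delta>)" using assms by simp
  have "exp x = ((1 - \<delta>) * exp \<delta>) * (exp x * exp (- \<delta>) / (1 - \<delta>))"
    using assms by (simp add: exp_minus field_simps)
  also have "\<dots> \<le> bell \<delta> x y"
    unfolding B by (rule mult_right_mono[OF one_minus_mult_exp_antimono[OF r] pos])
  finally show "exp x \<le> bell \<delta> x y" .
  have "bell \<delta> x y \<le> ((1 - 0) * exp 0) * (exp x * exp (- \<delta>) / (1 - \<delta>))"
    unfolding B by (rule mult_right_mono[OF one_minus_mult_exp_antimono[OF _ r(1)] pos]) simp
  then show "bell \<delta> x y \<le> JN_const \<delta> * exp x" by (simp add: JN_const_def mult.commute)
qed

text \<open>The hypothesis on the segment is strict so that the square root stays positive, hence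
  twice differentiable, along all of it.\<close>

lemma bell_concave:
  assumes "\<delta> < 1"
    and seg: "\<And>t. t \<in> {0..1} \<Longrightarrow> (y + t * q) - (x + t * p)\<^sup>2 < \<delta>\<^sup>2"
  shows "concave_on {0..1} (\<lambda>t. bell \<delta> (x + t * p) (y + t * q))"
proof -
  define R where "R = (\<lambda>t. sqrt (\<delta>\<^sup>2 - ((y + t * q) - (x + t * p)\<^sup>2)))"
  define R' where "R' = (\<lambda>t. (2 * p * (x + t * p) - q) / (2 * R t))"
  define k where "k = 1 / (1 - \<delta>)"
  define E where "E = (\<lambda>t. exp (x + t * p + R t - \<delta>) * k)"
  have Rpos: "R t > 0" if "t \<in> {0..1}" for t
    using seg[OF that] by (auto simp: R_def)
  have dR: "(R has_real_derivative R' t) (at t)" if "t \<in> {0..1}" for t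
    unfolding R_def R'_def using seg[OF that]
    by (auto intro!: derivative_eq_intros simp: field_simps)
  \<comment> \<open>The square of \<open>R\<close> is a quadratic polynomial in t with leading
    coefficient p^2; differentiating it twice gives R R'' + R'^2 = p^2.\<close>
  have dR': "(R' has_real_derivative (p\<^sup>2 - (R' t)\<^sup>2) / R t) (at t)" if "t \<in> {0..1}" for t
    unfolding R'_def using Rpos[OF that]
    by (auto intro!: derivative_eq_intros dR[OF that] simp: R'_def field_simps power2_eq_square)
  have dE: "(E has_real_derivative (p + R' t) * E t) (at t)" if "t \<in> {0..1}" for t
    unfolding E_def
    by (auto intro!: derivative_eq_intros dR[OF that] simp: algebra_simps)
  txt \<open>The identity \<open>R R'' = p\<^sup>2 - R'\<^sup>2\<close> makes the second derivative collapse to \<open>- R (p + R')\<^sup>2 E\<close>.\<close>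
  have "concave_on {0..1} (\<lambda>t. (1 - R t) * E t)"
  proof (rule f''_le0_imp_concave)
    fix t :: real assume t: "t \<in> {0..1}"
    show "((\<lambda>t. (1 - R t) * E t) has_real_derivative (p - R t * (p + R' t)) * E t) (at t)"
      by (auto intro!: derivative_eq_intros dR[OF t] dE[OF t] simp: algebra_simps)
    show "((\<lambda>t. (p - R t * (p + R' t)) * E t) has_real_derivative - R t * (p + R' t)\<^sup>2 * E t) (at t)"
      using Rpos[OF t]
      by (auto intro!: derivative_eq_intros dR[OF t] dR'[OF t] dE[OF t] simp: field_simps power2_eq_square)
    show "- R t * (p + R' t)\<^sup>2 * E t \<le> 0"
      using Rpos[OF t] assms(1) by (auto simp: E_def k_def)
  qed simp
  then show ?thesis by (simp add: bell_def R_def E_def k_def)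
qed

section \<open>Cutting an interval inside the strip\<close>

text \<open>Increments add up, so the point of an interval divides the segment between the points of
  its two parts; the parameter is the relative length of the right part.\<close>

lemma dq_split:
  assumes "c < m" "m < d"
  shows "dq F c d = dq F c m + (d - m) / (d - c) * (dq F m d - dq F c m)"
proof -
  define X where "X = dq F c m"
  define Y where "Y = dq F m d"
  have "F m - F c = X * (m - c)" "F d - F m = Y * (d - m)"
    using assms by (auto simp: X_def Y_def dq_def)
  then have "F d - F c = X * (d - c) + (d - m) * (Y - X)" by (simp add: algebra_simps)
  then have "dq F c d = X + (d - m) / (d - c) * (Y - X)"
    using assms by (simp add: dq_def add_divide_distrib)
  then show ?thesis by (simp add: X_def Y_def)
qed

text \<open>A law of total variance. The last term shows that the variance y - x^2 is concave along
  lines and measures its excess over linear interpolation.\<close>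

lemma var_segment:
  fixes x y :: real
  shows "(y + t * (y' - y)) - (x + t * (x' - x))\<^sup>2
    = (1 - t) * (y - x\<^sup>2) + t * (y' - x'\<^sup>2) + t * (1 - t) * (x' - x)\<^sup>2"
  by (simp add: algebra_simps power2_eq_square)

text \<open>Here (x', y') is the heavy part, of weight 1 - \<kappa>. The total variance bounds
  \<kappa> (1 - \<kappa>) (x'' - x')^2 by e, so (x' - x)^2 = \<kappa>^2 (x'' - x')^2 is at most 4 (D
  - e). As t (1 - t) \<le> 1/4, the variance on the segment exceeds e by at most D - e.\<close>

lemma var_segment_short:
  fixes x y :: real
  assumes x: "x = x' + \<kappa> * (x'' - x')" "y = y' + \<kappa> * (y'' - y')"
    and nonneg: "0 \<le> y' - x'\<^sup>2" "0 \<le> y'' - x''\<^sup>2"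
    and le: "y - x\<^sup>2 \<le> e" "y' - x'\<^sup>2 \<le> e"
    and \<kappa>: "0 < \<kappa>" "\<kappa> < 1" "e * \<kappa> \<le> 4 * (D - e) * (1 - \<kappa>)"
    and t: "t \<in> {0..1}"
  shows "(y + t * (y' - y)) - (x + t * (x' - x))\<^sup>2 \<le> D"
proof -
  define v where "v = (x'' - x')\<^sup>2"
  have "y - x\<^sup>2 = (1 - \<kappa>) * (y' - x'\<^sup>2) + \<kappa> * (y'' - x''\<^sup>2) + \<kappa> * (1 - \<kappa>) * v"
    unfolding x v_def by (rule var_segment)
  moreover have "0 \<le> (1 - \<kappa>) * (y' - x'\<^sup>2) + \<kappa> * (y'' - x''\<^sup>2)"
    using nonneg \<kappa> by (intro add_nonneg_nonneg mult_nonneg_nonneg) auto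
  ultimately have "\<kappa> * (1 - \<kappa>) * v \<le> e" using le by linarith
  then have "\<kappa> * (\<kappa> * (1 - \<kappa>) * v) \<le> \<kappa> * e" using \<kappa> by (intro mult_left_mono) auto
  with \<kappa>(3) have "(1 - \<kappa>) * (\<kappa>\<^sup>2 * v) \<le> (1 - \<kappa>) * (4 * (D - e))"
    by (simp add: algebra_simps power2_eq_square)
  moreover have dist: "(x' - x)\<^sup>2 = \<kappa>\<^sup>2 * v"
    unfolding x v_def by (simp add: power_mult_distrib)
  ultimately have d: "(x' - x)\<^sup>2 \<le> 4 * (D - e)" using \<kappa> by simp
  have "t * (1 - t) \<le> 1 / 4"
    using zero_le_power2[of "t - 1/2"] by (simp add: power2_eq_square algebra_simps)
  then have "t * (1 - t) * (x' - x)\<^sup>2 \<le> 1 / 4 * (4 * (D - e))"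
    using d by (intro mult_mono) auto
  moreover have "(1 - t) * (y - x\<^sup>2) + t * (y' - x'\<^sup>2) \<le> (1 - t) * e + t * e"
    using t le by (intro add_mono mult_left_mono) auto
  ultimately show ?thesis unfolding var_segment by (simp add: algebra_simps)
qed

text \<open>If the segments to both sides left the strip, (x, y) would lie between two points of
  variance above D on one line, and concavity would push its own variance to at least D.\<close>

lemma var_two_sided:
  fixes x y :: real
  assumes x: "x = x1 + l * (x2 - x1)" "y = y1 + l * (y2 - y1)" and l: "0 < l" "l < 1"
    and lt: "y - x\<^sup>2 < D" and t: "t \<in> {0..1}" "t' \<in> {0..1}"
    and gt: "D < (y + t * (y2 - y)) - (x + t * (x2 - x))\<^sup>2"
  shows "(y + t' * (y1 - y)) - (x + t' * (x1 - x))\<^sup>2 \<le> D"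
proof (rule ccontr)
  assume "\<not> ?thesis"
  then have gt': "D < (y + t' * (y1 - y)) - (x + t' * (x1 - x))\<^sup>2" by simp
  have tpos: "0 < t" "0 < t'" using t gt gt' lt by (cases "t = 0"; cases "t' = 0"; simp)+
  define P1 P2 Q1 Q2 where "P1 = x + t * (x2 - x)" and "P2 = y + t * (y2 - y)"
    and "Q1 = x + t' * (x1 - x)" and "Q2 = y + t' * (y1 - y)"
  \<comment> \<open>Relative to the segment between the two parts, P lies at distance (1 - l) t on
    one side of (x, y) and Q at distance l t' on the other. Hence b is the weight for which (x, y) =
    (1 - b) P + b Q.\<close>
  define N where "N = l * t' + (1 - l) * t"
  define b where "b = (1 - l) * t / N"
  have N: "0 < N" using l tpos by (auto simp: N_def intro!: add_pos_pos)
  have "(1 - l) * t < N" using l tpos by (simp add: N_def)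
  then have b: "0 < b" "b < 1" using l tpos N by (auto simp: b_def)
  have bN: "b * N = (1 - l) * t" using N by (simp add: b_def)
  have aux: "N * (z + t * (z2 - z) + b * (z + t' * (z1 - z) - (z + t * (z2 - z)))) = N * z"
    if "z = z1 + l * (z2 - z1)" for z z1 z2
  proof -
    have "N * (z + t * (z2 - z) + b * (z + t' * (z1 - z) - (z + t * (z2 - z))))
      = N * z + N * t * (z2 - z) + (b * N) * (t' * (z1 - z) - t * (z2 - z))"
      by (simp add: algebra_simps)
    also have "\<dots> = N * z" unfolding bN unfolding N_def that by (simp add: algebra_simps)
    finally show ?thesis .
  qed
  have "P1 + b * (Q1 - P1) = x" "P2 + b * (Q2 - P2) = y"
    using aux[OF x(1)] aux[OF x(2)] N by (auto simp: P1_def P2_def Q1_def Q2_def)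
  then have "y - x\<^sup>2 = (1 - b) * (P2 - P1\<^sup>2) + b * (Q2 - Q1\<^sup>2) + b * (1 - b) * (Q1 - P1)\<^sup>2"
    using var_segment[of P2 b Q2 P1 Q1] by simp
  moreover have "(1 - b) * D + b * D \<le> (1 - b) * (P2 - P1\<^sup>2) + b * (Q2 - Q1\<^sup>2)"
    using b gt gt' by (intro add_mono mult_left_mono) (auto simp: P1_def P2_def Q1_def Q2_def)
  moreover have "0 \<le> b * (1 - b) * (Q1 - P1)\<^sup>2" using b by simp
  ultimately show False using lt by (simp add: algebra_simps)
qed

text \<open>Write \<open>x\<close>, \<open>x\<^sub>-\<close>, \<open>x\<^sub>+\<close> for the points of \<open>[c, d]\<close>, \<open>[c, m]\<close>, \<open>[m, d]\<close>.  The cuts \<open>m\<close> whose segment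
  \<open>[x, x\<^sub>+]\<close> stays in the strip and those whose segment \<open>[x, x\<^sub>-]\<close> does form two closed sets.  They cover
  all admissible cuts, because \<open>x\<close> is deep in the strip and the variance is concave along lines; and
  each contains an extreme cut, where its segment is short.  By connectedness they share a cut.\<close>

lemma cut_in_strip:
  fixes F G :: "real \<Rightarrow> real"
  assumes cd: "c < d" and cont: "continuous_on {c..d} F" "continuous_on {c..d} G"
    and var: "\<And>u v. c \<le> u \<Longrightarrow> u < v \<Longrightarrow> v \<le> d \<Longrightarrow> (dq F u v)\<^sup>2 \<le> dq G u v"
             "\<And>u v. c \<le> u \<Longrightarrow> u < v \<Longrightarrow> v \<le> d \<Longrightarrow> dq G u v - (dq F u v)\<^sup>2 \<le> \<epsilon>\<^sup>2"
    and \<epsilon>\<delta>: "0 \<le> \<epsilon>" "\<epsilon> < \<delta>" 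
    and \<kappa>: "0 < \<kappa>" "\<kappa> \<le> 1/2" "\<epsilon>\<^sup>2 * \<kappa> \<le> 4 * (\<delta>\<^sup>2 - \<epsilon>\<^sup>2) * (1 - \<kappa>)"
  obtains m where "c + \<kappa> * (d - c) \<le> m" "m \<le> d - \<kappa> * (d - c)"
    "\<And>t. t \<in> {0..1} \<Longrightarrow> (dq G c m + t * (dq G m d - dq G c m))
          - (dq F c m + t * (dq F m d - dq F c m))\<^sup>2 \<le> \<delta>\<^sup>2"
proof -
  define l where "l = d - c"
  have l: "l > 0" using cd by (simp add: l_def)
  define S where "S = {c + \<kappa> * l .. d - \<kappa> * l}"
  have kl: "0 < \<kappa> * l" "\<kappa> * l \<le> l / 2" using l \<kappa> by (auto simp: field_simps)
  have S: "c < m" "m < d" if "m \<in> S" for m using that kl by (auto simp: S_def)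
  \<comment> \<open>The variance at parameter t of the segment from the point of [c, d] to (x',
    y').\<close>
  define W where "W = (\<lambda>t x' y'. (dq G c d + t * (y' - dq G c d)) - (dq F c d + t * (x' - dq F c d))\<^sup>2)"
  define A where "A = {m \<in> S. \<forall>t\<in>{0..1}. W t (dq F m d) (dq G m d) \<le> \<delta>\<^sup>2}"
  define A' where "A' = {m \<in> S. \<forall>t\<in>{0..1}. W t (dq F c m) (dq G c m) \<le> \<delta>\<^sup>2}"
  have sub: "S \<subseteq> {c..d}" using S by (auto simp: less_imp_le)
  have conts: "continuous_on S F" "continuous_on S G" using cont sub by (auto intro: continuous_on_subset)
  have contdq: "continuous_on S (\<lambda>m. dq F m d)" "continuous_on S (\<lambda>m. dq G m d)"
    "continuous_on S (\<lambda>m. dq F c m)" "continuous_on S (\<lambda>m. dq G c m)"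
    using S unfolding dq_def by (fastforce intro!: continuous_on_divide continuous_on_diff conts
      continuous_on_const continuous_on_id)+
  have closedA: "closed A"
  proof -
    have "A = S \<inter> (\<Inter>t\<in>{0..1}. {m \<in> S. W t (dq F m d) (dq G m d) \<le> \<delta>\<^sup>2})" by (auto simp: A_def)
    moreover have "closed {m \<in> S. W t (dq F m d) (dq G m d) \<le> \<delta>\<^sup>2}" for t
      unfolding W_def
      by (intro continuous_on_closed_Collect_le continuous_intros contdq) (simp add: S_def)
    ultimately show ?thesis by (auto simp: S_def)
  qed
  have closedA': "closed A'"
  proof -
    have "A' = S \<inter> (\<Inter>t\<in>{0..1}. {m \<in> S. W t (dq F c m) (dq G c m) \<le> \<delta>\<^sup>2})" by (auto simp: A'_def)
    moreover have "closed {m \<in> S. W t (dq F c m) (dq G c m) \<le> \<delta>\<^sup>2}" for t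
      unfolding W_def
      by (intro continuous_on_closed_Collect_le continuous_intros contdq) (simp add: S_def)
    ultimately show ?thesis by (auto simp: S_def)
  qed
  define x where "x = dq F c d"
  define y where "y = dq G c d"
  have W: "W t x' y' = (y + t * (y' - y)) - (x + t * (x' - x))\<^sup>2" for t x' y'
    by (simp add: W_def x_def y_def)
  define w where "w = (\<lambda>m. (d - m) / l)"
  have w: "0 < w m" "w m < 1" if "m \<in> S" for m
    using S[OF that] l by (auto simp: w_def l_def)
  have x: "x = dq F c m + w m * (dq F m d - dq F c m)"
    and y: "y = dq G c m + w m * (dq G m d - dq G c m)" if "m \<in> S" for m
    using dq_split[OF S[OF that]] by (auto simp: w_def x_def y_def l_def)
  have xy: "y - x\<^sup>2 \<le> \<epsilon>\<^sup>2" using var(2)[of c d] cd by (simp add: x_def y_def)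
  have \<epsilon>\<delta>2: "\<epsilon>\<^sup>2 < \<delta>\<^sup>2" using \<epsilon>\<delta> by (intro power_strict_mono) auto
  have cover: "S \<subseteq> A \<union> A'"
  proof
    fix m assume m: "m \<in> S"
    have "y - x\<^sup>2 < \<delta>\<^sup>2" using xy \<epsilon>\<delta>2 by simp
    note two_sided = var_two_sided[OF x[OF m] y[OF m] w[OF m] this]
    show "m \<in> A \<union> A'"
    proof (cases "m \<in> A")
      case False
      then obtain t where "t \<in> {0..1}" "\<delta>\<^sup>2 < W t (dq F m d) (dq G m d)"
        using m by (auto simp: A_def not_le)
      with two_sided[of t] m show ?thesis by (simp add: A'_def W)
    qed simp
  qed
  \<comment> \<open>At the leftmost cut the right piece has weight 1 - \<kappa>, so it is the heavy
    part and its point is close to that of [c, d]. The rightmost cut is the mirror image.\<close>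
  have "c + \<kappa> * l \<in> A"
  proof -
    let ?m = "c + \<kappa> * l"
    have m: "?m \<in> S" using kl by (auto simp: S_def l_def)
    have wm: "w ?m = 1 - \<kappa>" using l by (simp add: w_def field_simps) (simp add: l_def)
    have "x = dq F ?m d + \<kappa> * (dq F c ?m - dq F ?m d)"
      "y = dq G ?m d + \<kappa> * (dq G c ?m - dq G ?m d)"
      using x[OF m, unfolded wm] y[OF m, unfolded wm] by (simp_all add: algebra_simps)
    from var_segment_short[OF this _ _ xy _ \<kappa>(1) _ \<kappa>(3)]
    show ?thesis unfolding A_def W using m S[OF m] var[of ?m d] var[of c ?m] \<kappa> by auto
  qed
  moreover have "d - \<kappa> * l \<in> A'"
  proof -
    let ?m = "d - \<kappa> * l"
    have m: "?m \<in> S" using kl by (auto simp: S_def l_def)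
    have "w ?m = \<kappa>" using l by (simp add: w_def)
    then have "x = dq F c ?m + \<kappa> * (dq F ?m d - dq F c ?m)"
      "y = dq G c ?m + \<kappa> * (dq G ?m d - dq G c ?m)"
      using x[OF m] y[OF m] by auto
    from var_segment_short[OF this _ _ xy _ \<kappa>(1) _ \<kappa>(3)]
    show ?thesis unfolding A'_def W using m S[OF m] var[of ?m d] var[of c ?m] \<kappa> by auto
  qed
  moreover have "connected S" by (simp add: S_def)
  moreover have "A \<subseteq> S" "A' \<subseteq> S" by (auto simp: A_def A'_def)
  ultimately have "A \<inter> A' \<inter> S \<noteq> {}"
    using closedA closedA' cover unfolding connected_closed by blast
  then obtain m where m: "m \<in> A" "m \<in> A'" "m \<in> S" by auto
  show ?thesis
  proof
    show "c + \<kappa> * (d - c) \<le> m" "m \<le> d - \<kappa> * (d - c)" using m by (auto simp: S_def l_def)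
    fix t :: real assume t: "t \<in> {0..1}"
    let ?l = "w m"
    note lm = w[OF m(3)]
    show "(dq G c m + t * (dq G m d - dq G c m)) - (dq F c m + t * (dq F m d - dq F c m))\<^sup>2 \<le> \<delta>\<^sup>2"
    \<comment> \<open>The point of [c, d] sits at parameter \<open>w m\<close> of the full segment.
      Beyond it the segment runs towards the right point, before it towards the left one; u is the
      rescaled parameter.\<close>
    proof (cases "?l \<le> t")
      case True
      define u where "u = (t - ?l) / (1 - ?l)"
      have u: "u * (1 - ?l) = t - ?l" "u \<in> {0..1}" using True lm t by (auto simp: u_def field_simps)
      have "z1 + t * (z2 - z1) = z + u * (z2 - z)" if "z = z1 + ?l * (z2 - z1)" for z z1 z2 :: real
      proof -
        have "z + u * (z2 - z) = z + (u * (1 - ?l)) * (z2 - z1)" unfolding that by (simp add: algebra_simps)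
        then show ?thesis unfolding u that by (simp add: algebra_simps)
      qed
      from this[OF x[OF m(3)]] this[OF y[OF m(3)]] u(2) m(1) show ?thesis
        by (auto simp: A_def W)
    next
      case False
      define u where "u = (?l - t) / ?l"
      have u: "u * ?l = ?l - t" "u \<in> {0..1}" using False lm t by (auto simp: u_def field_simps)
      have "z1 + t * (z2 - z1) = z + u * (z1 - z)" if "z = z1 + ?l * (z2 - z1)" for z z1 z2 :: real
      proof -
        have "z + u * (z1 - z) = z - (u * ?l) * (z2 - z1)" unfolding that by (simp add: algebra_simps)
        then show ?thesis unfolding u that by (simp add: algebra_simps)
      qed
      from this[OF x[OF m(3)]] this[OF y[OF m(3)]] u(2) m(2) show ?thesis
        by (auto simp: A'_def W)
    qed
  qed
qed

section \<open>The Bellman induction\<close>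

text \<open>Concavity along the segment between the points of the parts, read at the parameter of
  the whole interval and multiplied by its length.\<close>

lemma bell_split:
  assumes "c < m" "m < d" "\<delta> < 1"
    and seg: "\<And>t. t \<in> {0..1} \<Longrightarrow> (dq G c m + t * (dq G m d - dq G c m))
          - (dq F c m + t * (dq F m d - dq F c m))\<^sup>2 < \<delta>\<^sup>2"
  shows "(m - c) * bell \<delta> (dq F c m) (dq G c m) + (d - m) * bell \<delta> (dq F m d) (dq G m d)
    \<le> (d - c) * bell \<delta> (dq F c d) (dq G c d)"
proof -
  define w where "w = (d - m) / (d - c)"
  have w: "0 \<le> w" "w \<le> 1" "w * (d - c) = d - m" using assms by (auto simp: w_def)
  let ?f = "\<lambda>t. bell \<delta> (dq F c m + t * (dq F m d - dq F c m)) (dq G c m + t * (dq G m d - dq G c m))"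
  have "concave_on {0..1} ?f" using seg by (rule bell_concave[OF \<open>\<delta> < 1\<close>])
  from concave_onD[OF this w(1,2), of 0 1]
  have "(1 - w) * bell \<delta> (dq F c m) (dq G c m) + w * bell \<delta> (dq F m d) (dq G m d) \<le> ?f w"
    by simp
  also have "?f w = bell \<delta> (dq F c d) (dq G c d)"
    using dq_split[OF assms(1,2)] by (simp add: w_def)
  finally have "(d - c) * ((1 - w) * bell \<delta> (dq F c m) (dq G c m) + w * bell \<delta> (dq F m d) (dq G m d))
    \<le> (d - c) * bell \<delta> (dq F c d) (dq G c d)"
    using assms by (intro mult_left_mono) auto
  moreover have "(d - c) * ((1 - w) * X + w * Y) = (m - c) * X + (d - m) * Y" for X Y
  proof -
    have "(d - c) * ((1 - w) * X + w * Y) = (d - c) * X + (w * (d - c)) * (Y - X)"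
      by (simp add: algebra_simps)
    then show ?thesis unfolding w by (simp add: algebra_simps)
  qed
  ultimately show ?thesis by simp
qed

text \<open>The additive error is an increment of \<open>K\<close>, so that it does not grow when intervals are cut.\<close>

lemma bellman_induction:
  fixes F G H K :: "real \<Rightarrow> real"
  assumes cont: "continuous_on {a..b} F" "continuous_on {a..b} G"
    and var: "\<And>u v. a \<le> u \<Longrightarrow> u < v \<Longrightarrow> v \<le> b \<Longrightarrow> (dq F u v)\<^sup>2 \<le> dq G u v"
             "\<And>u v. a \<le> u \<Longrightarrow> u < v \<Longrightarrow> v \<le> b \<Longrightarrow> dq G u v - (dq F u v)\<^sup>2 \<le> \<epsilon>\<^sup>2"
    and \<epsilon>\<delta>: "0 \<le> \<epsilon>" "\<epsilon> < \<delta>" "\<delta> < 1"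
    and small: "0 < \<rho>"
      "\<And>c d. a \<le> c \<Longrightarrow> c < d \<Longrightarrow> d \<le> b \<Longrightarrow> d - c < \<rho> \<Longrightarrow>
         H d - H c \<le> (d - c) * bell \<delta> (dq F c d) (dq G c d) + (K d - K c)"
    and ab: "a < b"
  shows "H b - H a \<le> (b - a) * bell \<delta> (dq F a b) (dq G a b) + (K b - K a)"
proof -
  \<comment> \<open>The cut only guarantees a weak bound, while concavity of \<open>bell\<close>
    needs a strict one; cutting within the strip of parameter \<gamma> < \<delta> bridges the
    gap.\<close>
  define \<gamma> where "\<gamma> = (\<epsilon> + \<delta>) / 2"
  have \<gamma>: "\<epsilon> < \<gamma>" "\<gamma> < \<delta>" using \<epsilon>\<delta> by (auto simp: \<gamma>_def)
  have sq: "\<epsilon>\<^sup>2 < \<gamma>\<^sup>2" "\<gamma>\<^sup>2 < \<delta>\<^sup>2" using \<gamma> \<epsilon>\<delta> by (auto intro!: power_strict_mono)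
  \<comment> \<open>Since \<epsilon> < 1 and 1 - \<kappa> \<ge> 1/2, this choice meets the smallness
    condition of \<open>cut_in_strip\<close>. It depends on \<epsilon> and \<delta> only, so the
    same ratio serves at every level.\<close>
  define \<kappa> where "\<kappa> = min (1/2) (\<gamma>\<^sup>2 - \<epsilon>\<^sup>2)"
  have \<kappa>: "0 < \<kappa>" "\<kappa> \<le> 1/2" "\<kappa> \<le> \<gamma>\<^sup>2 - \<epsilon>\<^sup>2" using sq unfolding \<kappa>_def by (simp, linarith, linarith)
  have "\<epsilon>\<^sup>2 * \<kappa> \<le> 1 * \<kappa>" using \<epsilon>\<delta> \<kappa> by (intro mult_right_mono) (auto simp: power_le_one)
  also have "\<dots> \<le> 4 * (\<gamma>\<^sup>2 - \<epsilon>\<^sup>2) * (1/2)" using \<kappa> by simp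
  also have "\<dots> \<le> 4 * (\<gamma>\<^sup>2 - \<epsilon>\<^sup>2) * (1 - \<kappa>)" using \<kappa> sq by (intro mult_left_mono) auto
  finally have \<kappa>': "\<epsilon>\<^sup>2 * \<kappa> \<le> 4 * (\<gamma>\<^sup>2 - \<epsilon>\<^sup>2) * (1 - \<kappa>)" .
  \<comment> \<open>Each piece of a cut has at most 1 - \<kappa> times the length of the whole, so n
    bounds the number of cuts needed to get below length \<rho>.\<close>
  have step: "H d - H c \<le> (d - c) * bell \<delta> (dq F c d) (dq G c d) + (K d - K c)"
    if "a \<le> c" "c < d" "d \<le> b" "(1 - \<kappa>) ^ n * (d - c) < \<rho>" for n c d
    using that
  proof (induction n arbitrary: c d)
    case 0
    then show ?case using small(2) by simp
  next
    case (Suc n)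
    have cont': "continuous_on {c..d} F" "continuous_on {c..d} G"
      using cont Suc.prems by (auto elim: continuous_on_subset)
    have var': "(dq F u v)\<^sup>2 \<le> dq G u v" "dq G u v - (dq F u v)\<^sup>2 \<le> \<epsilon>\<^sup>2"
      if "c \<le> u" "u < v" "v \<le> d" for u v
      using var[of u v] that Suc.prems by auto
    obtain m where m: "c + \<kappa> * (d - c) \<le> m" "m \<le> d - \<kappa> * (d - c)"
      and seg: "\<And>t. t \<in> {0..1} \<Longrightarrow> (dq G c m + t * (dq G m d - dq G c m))
          - (dq F c m + t * (dq F m d - dq F c m))\<^sup>2 \<le> \<gamma>\<^sup>2"
      using cut_in_strip[OF \<open>c < d\<close> cont' var' \<epsilon>\<delta>(1) \<gamma>(1) \<kappa>(1,2) \<kappa>'] by blast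
    have "0 < \<kappa> * (d - c)" using \<kappa> Suc.prems by simp
    then have cmd: "c < m" "m < d" using m by auto
    have small': "(1 - \<kappa>) ^ n * l < \<rho>" if "l \<le> (1 - \<kappa>) * (d - c)" for l
    proof -
      have "(1 - \<kappa>) ^ n * l \<le> (1 - \<kappa>) ^ n * ((1 - \<kappa>) * (d - c))"
        using that \<kappa> by (intro mult_left_mono) auto
      then show ?thesis using Suc.prems(4) by (simp add: mult.assoc mult.commute mult.left_commute)
    qed
    have "H m - H c \<le> (m - c) * bell \<delta> (dq F c m) (dq G c m) + (K m - K c)"
      using Suc.prems cmd m by (intro Suc.IH small') (auto simp: algebra_simps)
    moreover have "H d - H m \<le> (d - m) * bell \<delta> (dq F m d) (dq G m d) + (K d - K m)"
      using Suc.prems cmd m by (intro Suc.IH small') (auto simp: algebra_simps)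
    moreover have "(m - c) * bell \<delta> (dq F c m) (dq G c m) + (d - m) * bell \<delta> (dq F m d) (dq G m d)
        \<le> (d - c) * bell \<delta> (dq F c d) (dq G c d)"
      using seg sq(2) by (intro bell_split cmd \<epsilon>\<delta>(3)) (meson le_less_trans)
    ultimately show ?case by linarith
  qed
  obtain n where "(1 - \<kappa>) ^ n < \<rho> / (b - a)"
    using real_arch_pow_inv[of "\<rho> / (b - a)" "1 - \<kappa>"] \<kappa> small(1) ab by auto
  then show ?thesis using ab by (intro step[of a b n]) (auto simp: field_simps)
qed

section \<open>Bounded functions: approximation, oscillation and mean squares\<close>

lemma bounded_integrable_on:
  fixes f :: "real \<Rightarrow> real"
  assumes "f \<in> borel_measurable lebesgue" "\<And>x. x \<in> {c..d} \<Longrightarrow> \<bar>f x\<bar> \<le> B"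
  shows "f integrable_on {c..d}"
proof (rule measurable_bounded_by_integrable_imp_integrable)
  show "f \<in> borel_measurable (lebesgue_on {c..d})" using assms(1) by (rule measurable_restrict_space1)
qed (use assms in auto)

text \<open>A measurable function is an almost everywhere limit of continuous ones. Truncating these
  at height B makes dominated convergence applicable.\<close>

lemma continuous_approximation:
  fixes f :: "real \<Rightarrow> real"
  assumes f: "f \<in> borel_measurable lebesgue" "\<And>x. \<bar>f x\<bar> \<le> B" and "0 < \<eta>"
  obtains g :: "real \<Rightarrow> real" where "continuous_on UNIV g" "\<And>x. \<bar>g x\<bar> \<le> B"
    "integral {a..b} (\<lambda>x. \<bar>f x - g x\<bar>) < \<eta>"
proof -
  have "f measurable_on UNIV" using f(1) by (intro lebesgue_measurable_imp_measurable_on) auto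
  then obtain N h where N: "negligible N" and h: "\<And>n. continuous_on UNIV (h n)"
      "\<And>x. x \<notin> N \<Longrightarrow> (\<lambda>n. h n x) \<longlonglongrightarrow> f x"
    unfolding measurable_on_def by auto
  define g where "g = (\<lambda>n x. max (- B) (min B (h n x)))"
  have B: "0 \<le> B" using f(2)[of 0] by linarith
  have gcont: "continuous_on UNIV (g n)" for n unfolding g_def by (intro continuous_intros h)
  have gB: "\<bar>g n x\<bar> \<le> B" for n x using B by (auto simp: g_def)
  have glim: "(\<lambda>n. g n x) \<longlonglongrightarrow> f x" if "x \<notin> N" for x
  proof -
    have "(\<lambda>n. g n x) \<longlonglongrightarrow> max (- B) (min B (f x))"
      unfolding g_def by (intro tendsto_intros h that)
    also have "max (- B) (min B (f x)) = f x" using f(2)[of x] by auto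
    finally show ?thesis .
  qed
  \<comment> \<open>Setting the error to 0 on the null set turns almost everywhere convergence into
    convergence at every point.\<close>
  define e where "e = (\<lambda>n x. if x \<in> N then 0 else \<bar>f x - g n x\<bar>)"
  have gm: "g n \<in> borel_measurable lebesgue" for n
    using borel_measurable_continuous_onI[OF gcont[of n]] by (intro measurable_completion) simp
  have int: "(\<lambda>x. \<bar>f x - g n x\<bar>) integrable_on {a..b}" for n
  proof (rule bounded_integrable_on)
    show "(\<lambda>x. \<bar>f x - g n x\<bar>) \<in> borel_measurable lebesgue" using f(1) gm[of n] by measurable
    show "\<bar>\<bar>f x - g n x\<bar>\<bar> \<le> 2 * B" for x using f(2)[of x] gB[of n x] by linarith
  qed
  have "(\<lambda>n. integral {a..b} (e n)) \<longlonglongrightarrow> integral {a..b} (\<lambda>x. 0)"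
  proof (rule dominated_convergence(2))
    show "e n integrable_on {a..b}" for n
      by (rule integrable_spike[OF int N, of _ n]) (auto simp: e_def)
    show "(\<lambda>x. 2 * B) integrable_on {a..b}" by auto
    show "norm (e n x) \<le> 2 * B" for n x using f(2)[of x] gB[of n x] B by (auto simp: e_def)
    show "(\<lambda>n. e n x) \<longlonglongrightarrow> 0" for x
    proof (cases "x \<in> N")
      case False
      have "(\<lambda>n. \<bar>f x - g n x\<bar>) \<longlonglongrightarrow> \<bar>f x - f x\<bar>" by (intro tendsto_intros glim False)
      then show ?thesis using False by (simp add: e_def)
    qed (simp add: e_def)
  qed
  moreover have "integral {a..b} (e n) = integral {a..b} (\<lambda>x. \<bar>f x - g n x\<bar>)" for n
    by (rule integral_spike[OF N]) (auto simp: e_def)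
  ultimately have "(\<lambda>n. integral {a..b} (\<lambda>x. \<bar>f x - g n x\<bar>)) \<longlonglongrightarrow> 0" by simp
  then have "\<forall>\<^sub>F n in sequentially. integral {a..b} (\<lambda>x. \<bar>f x - g n x\<bar>) < \<eta>"
    using \<open>0 < \<eta>\<close> by (rule order_tendstoD)
  then obtain n where "integral {a..b} (\<lambda>x. \<bar>f x - g n x\<bar>) < \<eta>"
    by (auto simp: eventually_sequentially)
  then show ?thesis using gcont gB that by blast
qed

text \<open>From the tangent inequality \<open>1 + (v - u) \<le> exp (v - u)\<close>, multiplied by
  \<open>exp u\<close>.\<close>

lemma exp_diff_le:
  fixes u v :: real
  assumes "u \<le> N"
  shows "exp u \<le> exp v + exp N * \<bar>u - v\<bar>"
proof -
  have "exp u * (1 + (v - u)) \<le> exp u * exp (v - u)"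
    by (intro mult_left_mono exp_ge_add_one_self) auto
  then have "exp u - exp v \<le> exp u * (u - v)" by (simp add: algebra_simps flip: exp_add)
  also have "\<dots> \<le> exp u * \<bar>u - v\<bar>" by (intro mult_left_mono) auto
  also have "\<dots> \<le> exp N * \<bar>u - v\<bar>" using assms by (intro mult_right_mono) auto
  finally show ?thesis by simp
qed

text \<open>The mean differs from k by at most the average of \<bar>f - k\<bar>; the triangle
  inequality then costs a factor 2. This allows the mean to be replaced by a value of the continuous
  approximation.\<close>

lemma mean_oscillation_le:
  fixes f :: "real \<Rightarrow> real"
  assumes cd: "c < d" and f: "f integrable_on {c..d}"
    and g: "(\<lambda>x. \<bar>f x - k\<bar>) integrable_on {c..d}"
    and int: "(\<lambda>x. \<bar>f x - integral {c..d} f / (d - c)\<bar>) integrable_on {c..d}"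
  shows "integral {c..d} (\<lambda>x. \<bar>f x - integral {c..d} f / (d - c)\<bar>)
    \<le> 2 * integral {c..d} (\<lambda>x. \<bar>f x - k\<bar>)"
proof -
  define m where "m = integral {c..d} f / (d - c)"
  have "(d - c) * (m - k) = integral {c..d} (\<lambda>x. f x - k)"
    using Henstock_Kurzweil_Integration.integral_diff[OF f integrable_const_ivl, of k] cd
    by (simp add: m_def right_diff_distrib)
  moreover have "\<bar>integral {c..d} (\<lambda>x. f x - k)\<bar> \<le> integral {c..d} (\<lambda>x. \<bar>f x - k\<bar>)"
    using integral_norm_bound_integral[OF integrable_diff[OF f integrable_const_ivl] g]
    by simp
  ultimately have 1: "(d - c) * \<bar>m - k\<bar> \<le> integral {c..d} (\<lambda>x. \<bar>f x - k\<bar>)"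
    using cd by (metis abs_mult abs_of_pos diff_gt_0_iff_gt)
  have "integral {c..d} (\<lambda>x. \<bar>f x - m\<bar>) \<le> integral {c..d} (\<lambda>x. \<bar>f x - k\<bar> + \<bar>m - k\<bar>)"
    using g int by (intro integral_le integrable_add) (auto simp: m_def)
  also have "\<dots> = integral {c..d} (\<lambda>x. \<bar>f x - k\<bar>) + (d - c) * \<bar>m - k\<bar>"
    using g cd by (subst Henstock_Kurzweil_Integration.integral_add) auto
  finally show ?thesis using 1 by (simp add: m_def)
qed

lemma dq_indefinite_integral:
  fixes f :: "real \<Rightarrow> real"
  assumes "f integrable_on {a..b}" "a \<le> c" "c < d" "d \<le> b"
  shows "dq (\<lambda>t. integral {a..t} f) c d = integral {c..d} f / (d - c)"
proof -
  have "f integrable_on {a..d}" using assms by (auto intro: integrable_subinterval_real)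
  from Henstock_Kurzweil_Integration.integral_combine[OF _ _ this, of c] show ?thesis
    using assms by (simp add: dq_def algebra_simps)
qed

text \<open>With k the mean it shows that the variance is nonnegative; for other k it shows that the
  mean minimizes the mean square deviation.\<close>

lemma mean_square_deviation:
  fixes f :: "real \<Rightarrow> real"
  assumes "c < d" "f integrable_on {c..d}" "(\<lambda>x. (f x)\<^sup>2) integrable_on {c..d}"
  shows "integral {c..d} (\<lambda>x. (f x - k)\<^sup>2) / (d - c)
    = integral {c..d} (\<lambda>x. (f x)\<^sup>2) / (d - c) - (integral {c..d} f / (d - c))\<^sup>2
      + (integral {c..d} f / (d - c) - k)\<^sup>2"
    "(\<lambda>x. (f x - k)\<^sup>2) integrable_on {c..d}"
proof -
  have "((\<lambda>x. (f x)\<^sup>2 - 2 * k * f x + k\<^sup>2) has_integral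
      integral {c..d} (\<lambda>x. (f x)\<^sup>2) - 2 * k * integral {c..d} f + (d - c) * k\<^sup>2) {c..d}"
    using assms has_integral_const_real[of "k\<^sup>2" c d]
    by (intro has_integral_add has_integral_diff has_integral_mult_right integrable_integral) auto
  moreover have "(\<lambda>x. (f x)\<^sup>2 - 2 * k * f x + k\<^sup>2) = (\<lambda>x. (f x - k)\<^sup>2)"
    by (auto simp: power2_diff)
  ultimately have I: "((\<lambda>x. (f x - k)\<^sup>2) has_integral
      integral {c..d} (\<lambda>x. (f x)\<^sup>2) - 2 * k * integral {c..d} f + (d - c) * k\<^sup>2) {c..d}"
    by simp
  then show "(\<lambda>x. (f x - k)\<^sup>2) integrable_on {c..d}" by blast
  define m where "m = integral {c..d} f / (d - c)"
  define q where "q = integral {c..d} (\<lambda>x. (f x)\<^sup>2) / (d - c)"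
  have "integral {c..d} f = (d - c) * m" "integral {c..d} (\<lambda>x. (f x)\<^sup>2) = (d - c) * q"
    using assms(1) by (simp_all add: m_def q_def)
  with integral_unique[OF I] have "integral {c..d} (\<lambda>x. (f x - k)\<^sup>2) = (d - c) * (q - 2 * k * m + k\<^sup>2)"
    by (simp add: algebra_simps)
  then have "integral {c..d} (\<lambda>x. (f x - k)\<^sup>2) / (d - c) = q - m\<^sup>2 + (m - k)\<^sup>2"
    using assms(1) by (simp add: power2_diff)
  then show "integral {c..d} (\<lambda>x. (f x - k)\<^sup>2) / (d - c)
    = integral {c..d} (\<lambda>x. (f x)\<^sup>2) / (d - c) - (integral {c..d} f / (d - c))\<^sup>2
      + (integral {c..d} f / (d - c) - k)\<^sup>2" by (simp add: m_def q_def)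
qed

text \<open>The Bellman induction runs for each \<delta> strictly between \<epsilon> and 1; the
  constant for \<epsilon> itself comes from letting \<delta> decrease to \<epsilon>.\<close>

lemma exp_integral_le_of_bounded:
  fixes f :: "real \<Rightarrow> real"
  assumes f: "f \<in> borel_measurable lebesgue" and N: "\<And>x. \<bar>f x\<bar> \<le> N" and ab: "a < b"
    and \<epsilon>: "0 \<le> \<epsilon>" "\<epsilon> < 1"
    and var: "\<And>c d. a \<le> c \<Longrightarrow> c < d \<Longrightarrow> d \<le> b \<Longrightarrow>
      integral {c..d} (\<lambda>x. (f x)\<^sup>2) / (d - c) - (integral {c..d} f / (d - c))\<^sup>2 \<le> \<epsilon>\<^sup>2"
  shows "integral {a..b} (\<lambda>x. exp (f x)) \<le> (b - a) * (JN_const \<epsilon> * exp (integral {a..b} f / (b - a)))"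
proof -
  have Npos: "0 \<le> N" using N[of 0] by linarith
  have int_f: "f integrable_on {c..d}" for c d by (rule bounded_integrable_on[OF f N])
  have int_f2: "(\<lambda>x. (f x)\<^sup>2) integrable_on {c..d}" for c d
  proof (rule bounded_integrable_on)
    show "(\<lambda>x. (f x)\<^sup>2) \<in> borel_measurable lebesgue" using f by measurable
    show "\<bar>(f x)\<^sup>2\<bar> \<le> N\<^sup>2" for x using N[of x] Npos by (simp flip: abs_le_square_iff)
  qed
  have int_e: "(\<lambda>x. exp (f x)) integrable_on {c..d}" for c d
  proof (rule bounded_integrable_on)
    show "(\<lambda>x. exp (f x)) \<in> borel_measurable lebesgue" using f by measurable
    show "\<bar>exp (f x)\<bar> \<le> exp N" for x using N[of x] by (simp add: abs_le_iff)
  qed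
  have int_abs: "(\<lambda>x. \<bar>f x - g x\<bar>) integrable_on {c..d}"
    if "g \<in> borel_measurable lebesgue" "\<And>x. \<bar>g x\<bar> \<le> B" for g c d B
  proof (rule bounded_integrable_on)
    show "(\<lambda>x. \<bar>f x - g x\<bar>) \<in> borel_measurable lebesgue" using f that(1) by measurable
    show "\<bar>\<bar>f x - g x\<bar>\<bar> \<le> N + B" for x using N[of x] that(2)[of x] by linarith
  qed
  have int_k: "(\<lambda>x. \<bar>f x - k\<bar>) integrable_on {c..d}" for c d k
    by (rule int_abs[of "\<lambda>_. k" "\<bar>k\<bar>"]) auto
  define F where "F = (\<lambda>t. integral {a..t} f)"
  define G where "G = (\<lambda>t. integral {a..t} (\<lambda>x. (f x)\<^sup>2))"
  define H where "H = (\<lambda>t. integral {a..t} (\<lambda>x. exp (f x)))"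
  have dqF: "dq F c d = integral {c..d} f / (d - c)"
    and dqG: "dq G c d = integral {c..d} (\<lambda>x. (f x)\<^sup>2) / (d - c)" if "a \<le> c" "c < d" "d \<le> b" for c d
    unfolding F_def G_def using int_f int_f2 that by (auto intro: dq_indefinite_integral)
  have diff: "integral {a..d} h - integral {a..c} h = integral {c..d} h"
    if "h integrable_on {a..d}" "a \<le> c" "c < d" for h :: "real \<Rightarrow> real" and c d
    using Henstock_Kurzweil_Integration.integral_combine[OF _ _ that(1), of c] that by simp
  have cont: "continuous_on {a..b} F" "continuous_on {a..b} G"
    unfolding F_def G_def by (intro indefinite_integral_continuous_1 int_f int_f2)+
  have var1: "(dq F c d)\<^sup>2 \<le> dq G c d" if "a \<le> c" "c < d" "d \<le> b" for c d
  proof -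
    let ?m = "integral {c..d} f / (d - c)"
    have "0 \<le> integral {c..d} (\<lambda>x. (f x - ?m)\<^sup>2) / (d - c)"
      using mean_square_deviation(2)[OF that(2) int_f int_f2] that
      by (intro divide_nonneg_nonneg integral_nonneg) auto
    then show ?thesis
      unfolding mean_square_deviation(1)[OF that(2) int_f int_f2] dqF[OF that] dqG[OF that] by simp
  qed
  have var2: "dq G c d - (dq F c d)\<^sup>2 \<le> \<epsilon>\<^sup>2" if "a \<le> c" "c < d" "d \<le> b" for c d
    using var[OF that] unfolding dqF[OF that] dqG[OF that] .
  have bell: "integral {a..b} (\<lambda>x. exp (f x)) \<le> (b - a) * bell \<delta> (dq F a b) (dq G a b)"
    if \<delta>: "\<epsilon> < \<delta>" "\<delta> < 1" for \<delta>
  proof (rule field_le_epsilon)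
    fix e :: real assume "0 < e"
    \<comment> \<open>Chosen so that the total error \<open>K b - K a\<close> is at most e.\<close>
    define \<eta> where "\<eta> = e / (2 * exp N * (1 + (b - a)))"
    have \<eta>: "0 < \<eta>" using ab \<open>0 < e\<close> by (simp add: \<eta>_def)
    obtain g where g: "continuous_on UNIV g" "\<And>x. \<bar>g x\<bar> \<le> N"
        "integral {a..b} (\<lambda>x. \<bar>f x - g x\<bar>) < \<eta>"
      using continuous_approximation[OF f N \<eta>] by blast
    have gm: "g \<in> borel_measurable lebesgue"
      using borel_measurable_continuous_onI[OF g(1)] by (intro measurable_completion) simp
    note int_g = int_abs[OF gm g(2)]
    have "uniformly_continuous_on {a..b} g"
      using g(1) by (intro compact_uniformly_continuous) (auto elim: continuous_on_subset)
    then obtain \<rho> where \<rho>: "0 < \<rho>" "\<And>x y. x \<in> {a..b} \<Longrightarrow> y \<in> {a..b} \<Longrightarrow> dist x y < \<rho> \<Longrightarrow> dist (g x) (g y) < \<eta>"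
      using \<eta> unfolding uniformly_continuous_on_def by metis
    \<comment> \<open>Its increment over [c, d] dominates \<open>exp N\<close> times the integral of
      \<bar>f - m\<bar>, with m the mean of f on [c, d], as soon as d - c < \<rho>.\<close>
    define K where "K = (\<lambda>t. 2 * exp N * (integral {a..t} (\<lambda>x. \<bar>f x - g x\<bar>) + \<eta> * (t - a)))"
    have "H b - H a \<le> (b - a) * bell \<delta> (dq F a b) (dq G a b) + (K b - K a)"
    proof (rule bellman_induction[OF cont var1 var2 \<epsilon>(1) \<delta> \<rho>(1) _ ab])
      fix c d assume cd: "a \<le> c" "c < d" "d \<le> b" "d - c < \<rho>"
      define m where "m = integral {c..d} f / (d - c)"
      \<comment> \<open>On an interval shorter than \<rho> the function g stays within \<eta> of the
        constant \<open>g c\<close>.\<close>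
      have "integral {c..d} (\<lambda>x. \<bar>f x - g c\<bar>) \<le> integral {c..d} (\<lambda>x. \<bar>f x - g x\<bar> + \<eta>)"
      proof (rule integral_le)
        fix x assume "x \<in> {c..d}"
        then have "dist (g x) (g c) < \<eta>" using cd by (intro \<rho>(2)) (auto simp: dist_real_def)
        then show "\<bar>f x - g c\<bar> \<le> \<bar>f x - g x\<bar> + \<eta>" by (simp add: dist_real_def)
      qed (auto intro!: int_k int_g integrable_add)
      also have "\<dots> = integral {c..d} (\<lambda>x. \<bar>f x - g x\<bar>) + \<eta> * (d - c)"
        using int_g cd by (subst Henstock_Kurzweil_Integration.integral_add) auto
      finally have "integral {c..d} (\<lambda>x. \<bar>f x - m\<bar>) \<le> 2 * (integral {c..d} (\<lambda>x. \<bar>f x - g x\<bar>) + \<eta> * (d - c))"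
        using mean_oscillation_le[OF cd(2) int_f int_k int_k, of "g c"] by (simp add: m_def)
      then have osc: "exp N * integral {c..d} (\<lambda>x. \<bar>f x - m\<bar>)
          \<le> exp N * (2 * (integral {c..d} (\<lambda>x. \<bar>f x - g x\<bar>) + \<eta> * (d - c)))"
        by (intro mult_left_mono) auto
      have "H d - H c = integral {c..d} (\<lambda>x. exp (f x))"
        unfolding H_def using cd by (intro diff int_e) auto
      also have "\<dots> \<le> integral {c..d} (\<lambda>x. exp m + exp N * \<bar>f x - m\<bar>)"
        using N by (intro integral_le int_e integrable_add integrable_on_mult_right int_k)
          (auto intro!: exp_diff_le simp: abs_le_iff)
      also have "\<dots> = (d - c) * exp m + exp N * integral {c..d} (\<lambda>x. \<bar>f x - m\<bar>)"
        using int_k cd by (subst Henstock_Kurzweil_Integration.integral_add) auto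
      also have "\<dots> \<le> (d - c) * exp m + (K d - K c)"
        using osc diff[OF int_g cd(1,2)] by (simp add: K_def algebra_simps)
      also have "exp m \<le> bell \<delta> (dq F c d) (dq G c d)"
      proof -
        have "\<epsilon>\<^sup>2 \<le> \<delta>\<^sup>2" using \<epsilon> \<delta> by (intro power_mono) auto
        then have "exp (dq F c d) \<le> bell \<delta> (dq F c d) (dq G c d)"
          using var1[OF cd(1-3)] var2[OF cd(1-3)] \<epsilon> \<delta> by (intro bell_bounds; linarith)
        then show ?thesis by (simp add: dqF[OF cd(1-3)] m_def)
      qed
      finally show "H d - H c \<le> (d - c) * bell \<delta> (dq F c d) (dq G c d) + (K d - K c)"
        using cd by (simp add: mult_left_mono)
    qed
    moreover have "K b - K a \<le> 2 * exp N * (\<eta> * (1 + (b - a)))"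
      using g(3) by (simp add: K_def algebra_simps)
    moreover have "2 * exp N * (\<eta> * (1 + (b - a))) = e"
      using ab by (simp add: \<eta>_def)
    ultimately show "integral {a..b} (\<lambda>x. exp (f x)) \<le> (b - a) * bell \<delta> (dq F a b) (dq G a b) + e"
      by (simp add: H_def)
  qed
  have "integral {a..b} (\<lambda>x. exp (f x)) \<le> (b - a) * (JN_const \<delta> * exp (dq F a b))"
    if \<delta>: "\<epsilon> < \<delta>" "\<delta> < 1" for \<delta>
  proof -
    have "\<epsilon>\<^sup>2 \<le> \<delta>\<^sup>2" using \<epsilon> \<delta> by (intro power_mono) auto
    then have "bell \<delta> (dq F a b) (dq G a b) \<le> JN_const \<delta> * exp (dq F a b)"
      using var1[of a b] var2[of a b] \<epsilon> \<delta> ab by (intro bell_bounds; linarith)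
    then show ?thesis using bell[OF \<delta>] ab by (meson diff_gt_0_iff_gt less_imp_le mult_left_mono order_trans)
  qed
  then have "\<forall>\<^sub>F \<delta> in at_right \<epsilon>. integral {a..b} (\<lambda>x. exp (f x)) \<le> (b - a) * (JN_const \<delta> * exp (dq F a b))"
    using \<epsilon> by (auto simp: eventually_at_right)
  moreover have "((\<lambda>\<delta>. (b - a) * (JN_const \<delta> * exp (dq F a b))) \<longlongrightarrow> (b - a) * (JN_const \<epsilon> * exp (dq F a b))) (at_right \<epsilon>)"
    unfolding JN_const_def using \<epsilon> by (intro tendsto_intros) auto
  ultimately have "integral {a..b} (\<lambda>x. exp (f x)) \<le> (b - a) * (JN_const \<epsilon> * exp (dq F a b))"
    by (intro tendsto_lowerbound) auto
  then show ?thesis using dqF[of a b] ab by simp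
qed

section \<open>Averages over bounded intervals\<close>

text \<open>A bounded interval may or may not contain its endpoints. It differs from {c..d} by a
  null set, so averages can be computed on the closed interval.\<close>

definition has_endpoints :: "real set \<Rightarrow> real \<Rightarrow> real \<Rightarrow> bool" where
  "has_endpoints J c d \<longleftrightarrow> c < d \<and> {c<..<d} \<subseteq> J \<and> J \<subseteq> {c..d}"

lemma bounded_interval_endpoints:
  assumes "bounded_interval J"
  obtains c d where "has_endpoints J c d"
proof
  have J: "is_interval J" "bounded J" "0 < measure lebesgue J"
    using assms by (auto simp: bounded_interval_def)
  have ne: "J \<noteq> {}" using J(3) by auto
  have bdd: "bdd_below J" "bdd_above J"
    using J(2) by (auto simp: bounded_imp_bdd_below bounded_imp_bdd_above)
  have sub: "J \<subseteq> {Inf J..Sup J}" using bdd by (auto intro: cInf_lower cSup_upper)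
  have "x \<in> J" if h: "Inf J < x" "x < Sup J" for x
  proof -
    obtain y z where "y \<in> J" "y < x" "z \<in> J" "x < z"
      using h bdd ne by (meson cInf_less_iff less_cSup_iff)
    then show ?thesis using J(1) by (meson is_interval_1 less_imp_le)
  qed
  moreover have "Inf J < Sup J"
  proof (rule ccontr)
    assume "\<not> ?thesis"
    then have "J \<subseteq> {Inf J}" using sub by fastforce
    then have "negligible J" by (meson negligible_sing negligible_subset)
    then show False using J(3) by (simp add: negligible_imp_measure0)
  qed
  ultimately show "has_endpoints J (Inf J) (Sup J)" using sub by (auto simp: has_endpoints_def)
qed

lemma AE_has_endpoints:
  assumes "has_endpoints J c d"
  shows "AE x in lebesgue. x \<in> J \<longleftrightarrow> x \<in> {c..d}"
proof -
  have "negligible {c, d}" by simp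
  then have "AE x in lebesgue. x \<notin> {c, d}"
    by (intro AE_not_in) (simp add: negligible_iff_null_sets)
  then show ?thesis
    by eventually_elim (use assms in \<open>force simp: has_endpoints_def\<close>)
qed

lemma has_endpoints_sets:
  assumes "has_endpoints J c d"
  shows "J \<in> sets lebesgue"
proof -
  have "J = {c<..<d} \<union> (J \<inter> {c, d})" using assms by (force simp: has_endpoints_def)
  moreover have "J \<inter> {c, d} \<in> sets lebesgue" by (intro negligible_imp_sets negligible_finite) auto
  moreover have "{c<..<d} \<in> sets lebesgue" by simp
  ultimately show ?thesis by (metis sets.Un)
qed

lemma has_endpoints_emeasure:
  assumes "has_endpoints J c d"
  shows "emeasure lebesgue J = ennreal (d - c)" "measure lebesgue J = d - c"
proof -
  have "emeasure lebesgue J = emeasure lebesgue {c..d}"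
    using AE_has_endpoints[OF assms] has_endpoints_sets[OF assms]
    by (intro emeasure_eq_AE) auto
  then show "emeasure lebesgue J = ennreal (d - c)"
    using assms by (simp add: has_endpoints_def)
  then show "measure lebesgue J = d - c"
    using assms by (simp add: has_endpoints_def measure_def)
qed

lemma has_endpoints_bounded_interval:
  assumes "c < d"
  shows "bounded_interval {c<..<d}" "has_endpoints {c<..<d} c d"
  using assms by (auto simp: bounded_interval_def has_endpoints_def is_interval_1)

lemma avg_has_endpoints:
  assumes J: "has_endpoints J c d" and f: "set_integrable lebesgue J f"
  shows "avg J f = integral {c..d} f / (d - c)"
proof -
  have "negligible ({c..d} - J)"
    by (rule negligible_subset[of "{c, d}"]) (use J in \<open>force simp: has_endpoints_def\<close>)+
  then have "integral J f = integral {c..d} f"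
    using J by (intro integral_subset_negligible) (auto simp: has_endpoints_def)
  then show ?thesis
    using set_lebesgue_integral_eq_integral(2)[OF f]
    by (simp add: avg_def has_endpoints_emeasure[OF J])
qed

lemma ext_avg_has_endpoints:
  assumes J: "has_endpoints J c d"
  shows "ext_avg J f = enn2ereal ((\<integral>\<^sup>+x\<in>{c..d}. ennreal (f x) \<partial>lebesgue) / ennreal (d - c))"
proof -
  have "(\<integral>\<^sup>+x\<in>J. ennreal (f x) \<partial>lebesgue) = (\<integral>\<^sup>+x\<in>{c..d}. ennreal (f x) \<partial>lebesgue)"
    using AE_has_endpoints[OF J] by (intro nn_integral_cong_AE, eventually_elim) (auto simp: indicator_def)
  then show ?thesis by (simp add: ext_avg_def has_endpoints_emeasure[OF J])
qed

lemma nn_integral_eq_integral_interval: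
  fixes f :: "real \<Rightarrow> real"
  assumes "f integrable_on {c..d}" "\<And>x. x \<in> {c..d} \<Longrightarrow> 0 \<le> f x"
  shows "(\<integral>\<^sup>+x\<in>{c..d}. ennreal (f x) \<partial>lebesgue) = ennreal (integral {c..d} f)"
  using nn_integral_has_integral_lebesgue'[OF assms(2) integrable_integral[OF assms(1)]]
  by (simp add: nn_integral_completion)

lemma ext_avg_eq_integral:
  assumes J: "has_endpoints J c d" and f: "f integrable_on {c..d}" "\<And>x. x \<in> {c..d} \<Longrightarrow> 0 \<le> f x"
  shows "ext_avg J f = ereal (integral {c..d} f / (d - c))"
proof -
  have "c < d" using J by (simp add: has_endpoints_def)
  have "ext_avg J f = enn2ereal (ennreal (integral {c..d} f) / ennreal (d - c))"
    by (simp only: ext_avg_has_endpoints[OF J] nn_integral_eq_integral_interval[OF f])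
  also have "\<dots> = ereal (integral {c..d} f / (d - c))"
    using integral_nonneg[OF f] \<open>c < d\<close> by (simp add: divide_ennreal)
  finally show ?thesis .
qed

lemma integrable_on_of_nn_integral:
  fixes f :: "real \<Rightarrow> real"
  assumes f: "f \<in> borel_measurable lebesgue" "\<And>x. 0 \<le> f x"
    and fin: "(\<integral>\<^sup>+x\<in>{c..d}. ennreal (f x) \<partial>lebesgue) \<noteq> \<infinity>"
  shows "f integrable_on {c..d}"
proof -
  define g where "g = (\<lambda>x. indicator {c..d} x * f x)"
  have "(\<integral>\<^sup>+x\<in>{c..d}. ennreal (f x) \<partial>lebesgue) = integral\<^sup>N lebesgue g"
    by (intro nn_integral_cong) (auto simp: g_def indicator_def)
  with fin obtain r where r: "integral\<^sup>N lebesgue g = ennreal r" "0 \<le> r"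
    by (cases "integral\<^sup>N lebesgue g") auto
  have "g \<in> borel_measurable lebesgue" unfolding g_def by (intro borel_measurable_times borel_measurable_indicator f(1)) simp
  with r have "(g has_integral r) UNIV"
    using f(2) by (subst has_integral_iff_nn_integral_lebesgue) (auto simp: g_def)
  then have "g integrable_on UNIV" by blast
  moreover have "g = (\<lambda>x. if x \<in> {c..d} then f x else 0)" by (auto simp: g_def indicator_def)
  ultimately show ?thesis using integrable_restrict_UNIV[of "{c..d}" f] by simp
qed

section \<open>Variances of BMO functions as ordinary integrals\<close>

lemma BMO_eps_oscillation_le:
  assumes \<phi>: "\<phi> \<in> BMO_eps \<epsilon> I" and "0 \<le> \<epsilon>" and J: "bounded_interval J" "J \<subseteq> I"
  shows "ext_avg J (\<lambda>x. (\<phi> x)\<^sup>2) - ereal ((avg J \<phi>)\<^sup>2) \<le> ereal (\<epsilon>\<^sup>2)"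
proof -
  have fin: "BMO_sup I \<phi> < \<infinity>" and "sqrt (real_of_ereal (BMO_sup I \<phi>)) \<le> \<epsilon>"
    using \<phi> by (auto simp: BMO_eps_def BMO_def BMO_norm_def)
  then have "real_of_ereal (BMO_sup I \<phi>) \<le> \<epsilon>\<^sup>2" using \<open>0 \<le> \<epsilon>\<close> by (simp add: real_le_lsqrt sqrt_le_D)
  \<comment> \<open>Finiteness matters here: \<open>real_of_ereal\<close> sends \<infinity> to
    0.\<close>
  then have "BMO_sup I \<phi> \<le> ereal (\<epsilon>\<^sup>2)" using fin by (cases "BMO_sup I \<phi>") auto
  moreover have "ext_avg J (\<lambda>x. (\<phi> x)\<^sup>2) - ereal ((avg J \<phi>)\<^sup>2) \<le> BMO_sup I \<phi>"
    unfolding BMO_sup_def using J by (intro SUP_upper) auto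
  ultimately show ?thesis by (rule order_trans[rotated])
qed

lemma BMO_eps_variance:
  assumes \<phi>: "\<phi> \<in> BMO_eps \<epsilon> I" and "0 \<le> \<epsilon>" and I: "has_endpoints I a b"
    and f: "f \<in> borel_measurable lebesgue" "\<And>x. x \<in> I \<Longrightarrow> f x = \<phi> x"
    and cd: "a \<le> c" "c < d" "d \<le> b"
  shows "(\<lambda>x. (f x)\<^sup>2) integrable_on {c..d}"
    "integral {c..d} (\<lambda>x. (f x)\<^sup>2) / (d - c) - (integral {c..d} f / (d - c))\<^sup>2 \<le> \<epsilon>\<^sup>2"
proof -
  \<comment> \<open>The open interval lies in I whichever of its endpoints I contains.\<close>
  let ?J = "{c<..<d}"
  note J = has_endpoints_bounded_interval[OF cd(2)]
  have sub: "?J \<subseteq> I" using I cd by (auto simp: has_endpoints_def)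
  have "set_integrable lebesgue I \<phi>" using \<phi> by (auto simp: BMO_eps_def BMO_def)
  then have "set_integrable lebesgue ?J \<phi>" by (rule set_integrable_subset) (use sub in auto)
  moreover have "set_integrable lebesgue ?J \<phi> = set_integrable lebesgue ?J f"
    using sub f(2) by (intro set_integrable_cong) auto
  ultimately have fint: "set_integrable lebesgue ?J f" by simp
  have "avg ?J \<phi> = avg ?J f"
    unfolding avg_def set_lebesgue_integral_def using sub f(2)
    by (intro arg_cong2[where f="(/)"] Bochner_Integration.integral_cong) (auto simp: indicator_def)
  then have av: "avg ?J \<phi> = integral {c..d} f / (d - c)" using avg_has_endpoints[OF J(2) fint] by simp
  have ext: "ext_avg ?J (\<lambda>x. (\<phi> x)\<^sup>2) = ext_avg ?J (\<lambda>x. (f x)\<^sup>2)"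
    unfolding ext_avg_def using sub f(2)
    by (intro arg_cong[where f=enn2ereal] arg_cong2[where f="(/)"] nn_integral_cong)
       (auto simp: indicator_def)
  have le: "ext_avg ?J (\<lambda>x. (f x)\<^sup>2) - ereal ((integral {c..d} f / (d - c))\<^sup>2) \<le> ereal (\<epsilon>\<^sup>2)"
    using BMO_eps_oscillation_le[OF \<phi> \<open>0 \<le> \<epsilon>\<close> J(1) sub] unfolding av ext .
  \<comment> \<open>Subtracting a real number from \<infinity> leaves \<infinity>, so the bound
    forces the average of the square to be finite.\<close>
  then have "ext_avg ?J (\<lambda>x. (f x)\<^sup>2) \<noteq> \<infinity>" by auto
  then have "(\<integral>\<^sup>+x\<in>{c..d}. ennreal ((f x)\<^sup>2) \<partial>lebesgue) \<noteq> \<infinity>"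
    unfolding ext_avg_has_endpoints[OF J(2)] using cd by (auto simp: ennreal_top_divide)
  then show f2: "(\<lambda>x. (f x)\<^sup>2) integrable_on {c..d}"
    using f(1) by (intro integrable_on_of_nn_integral) auto
  show "integral {c..d} (\<lambda>x. (f x)\<^sup>2) / (d - c) - (integral {c..d} f / (d - c))\<^sup>2 \<le> \<epsilon>\<^sup>2"
    using le unfolding ext_avg_eq_integral[OF J(2) f2 zero_le_power2] by simp
qed

section \<open>The inequality\<close>

definition clamp :: "real \<Rightarrow> real \<Rightarrow> real" where
  "clamp n x = max (- n) (min n x)"

text \<open>Truncation is 1-Lipschitz. The truncated function is compared with the truncated mean m,
  which need not be its own mean but can only increase the mean square deviation.\<close>

lemma variance_clamp_le:
  fixes f :: "real \<Rightarrow> real"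
  assumes cd: "c < d" and f: "f \<in> borel_measurable lebesgue" "f integrable_on {c..d}"
    "(\<lambda>x. (f x)\<^sup>2) integrable_on {c..d}" and n: "0 \<le> n"
  shows "integral {c..d} (\<lambda>x. (clamp n (f x))\<^sup>2) / (d - c) - (integral {c..d} (\<lambda>x. clamp n (f x)) / (d - c))\<^sup>2
    \<le> integral {c..d} (\<lambda>x. (f x)\<^sup>2) / (d - c) - (integral {c..d} f / (d - c))\<^sup>2"
proof -
  define m where "m = integral {c..d} f / (d - c)"
  have le: "\<bar>clamp n x\<bar> \<le> n" for x using n by (auto simp: clamp_def)
  have T: "(\<lambda>x. clamp n (f x)) integrable_on {c..d}"
  proof (rule bounded_integrable_on)
    show "(\<lambda>x. clamp n (f x)) \<in> borel_measurable lebesgue" unfolding clamp_def using f(1) by measurable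
  qed (rule le)
  have T2: "(\<lambda>x. (clamp n (f x))\<^sup>2) integrable_on {c..d}"
  proof (rule bounded_integrable_on)
    show "(\<lambda>x. (clamp n (f x))\<^sup>2) \<in> borel_measurable lebesgue" unfolding clamp_def using f(1) by measurable
    show "\<bar>(clamp n (f x))\<^sup>2\<bar> \<le> n\<^sup>2" for x using le[of "f x"] n by (simp flip: abs_le_square_iff)
  qed
  have "integral {c..d} (\<lambda>x. (clamp n (f x))\<^sup>2) / (d - c) - (integral {c..d} (\<lambda>x. clamp n (f x)) / (d - c))\<^sup>2
    \<le> integral {c..d} (\<lambda>x. (clamp n (f x) - clamp n m)\<^sup>2) / (d - c)"
    unfolding mean_square_deviation(1)[OF cd T T2] by simp
  also have "\<dots> \<le> integral {c..d} (\<lambda>x. (f x - m)\<^sup>2) / (d - c)"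
  proof (intro divide_right_mono integral_le mean_square_deviation(2)[OF cd T T2] mean_square_deviation(2)[OF cd f(2,3)])
    show "(clamp n (f x) - clamp n m)\<^sup>2 \<le> (f x - m)\<^sup>2" for x
      using n by (simp flip: abs_le_square_iff) (auto simp: clamp_def max_def min_def)
  qed (use cd in auto)
  also have "\<dots> = integral {c..d} (\<lambda>x. (f x)\<^sup>2) / (d - c) - (integral {c..d} f / (d - c))\<^sup>2"
    unfolding mean_square_deviation(1)[OF cd f(2,3)] by (simp add: m_def)
  finally show ?thesis .
qed

text \<open>The bounded case applies to the truncations, whose variances are no larger. As
  integrability of \<open>exp\<close> of the function is not known in advance, Fatou's lemma carries
  out the limit on the left; dominated convergence handles the averages on the right.\<close>

lemma integral_JN_JN_const:
  assumes "bounded_interval I" and \<epsilon>: "0 \<le> \<epsilon>" "\<epsilon> < 1"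
  shows "integral_JN I \<epsilon> (JN_const \<epsilon>)"
  unfolding integral_JN_def
proof
  fix \<phi> assume \<phi>: "\<phi> \<in> BMO_eps \<epsilon> I"
  obtain a b where I: "has_endpoints I a b" using bounded_interval_endpoints[OF assms(1)] by blast
  have ab: "a < b" using I by (simp add: has_endpoints_def)
  have \<phi>int: "set_integrable lebesgue I \<phi>" using \<phi> by (auto simp: BMO_eps_def BMO_def)
  \<comment> \<open>Extension by zero, to have a function measurable on the whole line.\<close>
  define f where "f = (\<lambda>x. indicator I x *\<^sub>R \<phi> x)"
  have f\<phi>: "f x = \<phi> x" if "x \<in> I" for x using that by (simp add: f_def)
  have fint: "integrable lebesgue f" using \<phi>int by (simp add: f_def set_integrable_def)
  then have fm: "f \<in> borel_measurable lebesgue" by simp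
  have fabs: "f absolutely_integrable_on {c..d}" for c d
    unfolding set_integrable_def using fint by (intro integrable_mult_indicator) auto
  have fi: "f integrable_on {c..d}" for c d using fabs by (rule set_lebesgue_integral_eq_integral(1))
  have var: "(\<lambda>x. (f x)\<^sup>2) integrable_on {c..d}"
      "integral {c..d} (\<lambda>x. (f x)\<^sup>2) / (d - c) - (integral {c..d} f / (d - c))\<^sup>2 \<le> \<epsilon>\<^sup>2"
    if "a \<le> c" "c < d" "d \<le> b" for c d
    using BMO_eps_variance[OF \<phi> \<epsilon>(1) I fm _ that] f\<phi> by auto
  define M where "M = (\<lambda>n::nat. integral {a..b} (\<lambda>x. clamp n (f x)) / (b - a))"
  define R where "R = (\<lambda>m. (b - a) * (JN_const \<epsilon> * exp m))"
  have clamp_eq: "clamp n y = y" if "\<bar>y\<bar> \<le> n" for n y using that by (auto simp: clamp_def)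
  have clamp_le: "\<bar>clamp n y\<bar> \<le> \<bar>y\<bar>" "\<bar>clamp n y\<bar> \<le> n" if "0 \<le> n" for n y
    using that by (auto simp: clamp_def)
  have clamp_ev: "\<forall>\<^sub>F n in sequentially. clamp (real n) y = y" for y
  proof -
    obtain k :: nat where "\<bar>y\<bar> \<le> k" using real_arch_simple by blast
    then show ?thesis
      by (intro eventually_sequentiallyI[of k] clamp_eq) linarith
  qed
  have clamp_m: "(\<lambda>x. clamp n (f x)) \<in> borel_measurable lebesgue" for n
    unfolding clamp_def using fm by measurable
  have le: "integral {a..b} (\<lambda>x. exp (clamp n (f x))) \<le> R (M n)" for n :: nat
    unfolding R_def M_def
  proof (rule exp_integral_le_of_bounded[OF clamp_m _ ab \<epsilon>])
    show "\<bar>clamp n (f x)\<bar> \<le> n" for x by (rule clamp_le) simp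
    show "integral {c..d} (\<lambda>x. (clamp n (f x))\<^sup>2) / (d - c) - (integral {c..d} (\<lambda>x. clamp n (f x)) / (d - c))\<^sup>2 \<le> \<epsilon>\<^sup>2"
      if "a \<le> c" "c < d" "d \<le> b" for c d
      using variance_clamp_le[OF that(2) fm fi var(1)[OF that], of n] var(2)[OF that] by linarith
  qed
  have "(\<lambda>n. integral {a..b} (\<lambda>x. clamp (real n) (f x))) \<longlonglongrightarrow> integral {a..b} f"
  proof (rule dominated_convergence(2))
    show "(\<lambda>x. clamp (real n) (f x)) integrable_on {a..b}" for n
      by (rule bounded_integrable_on[OF clamp_m clamp_le(2)]) simp
    show "(\<lambda>x. \<bar>f x\<bar>) integrable_on {a..b}"
      using fabs by (simp add: absolutely_integrable_on_def)
    show "norm (clamp (real n) (f x)) \<le> \<bar>f x\<bar>" for n x using clamp_le(1)[of "real n"] by simp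
    show "(\<lambda>n. clamp (real n) (f x)) \<longlonglongrightarrow> f x" for x by (intro tendsto_eventually clamp_ev)
  qed
  then have "M \<longlonglongrightarrow> integral {a..b} f / (b - a)"
    unfolding M_def using ab by (intro tendsto_divide tendsto_const) auto
  then have RM: "(\<lambda>n. ennreal (R (M n))) \<longlonglongrightarrow> ennreal (R (integral {a..b} f / (b - a)))"
    unfolding R_def by (intro tendsto_ennrealI tendsto_mult tendsto_const tendsto_exp)
  let ?u = "\<lambda>n x. ennreal (exp (clamp (real n) (f x))) * indicator {a..b} x"
  \<comment> \<open>At each x the truncations are eventually constant in n.\<close>
  have lim: "liminf (\<lambda>n. ?u n x) = ennreal (exp (f x)) * indicator {a..b} x" for x
    by (intro lim_imp_Liminf tendsto_eventually eventually_mono[OF clamp_ev[of "f x"]]) auto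
  have "(\<integral>\<^sup>+x\<in>{a..b}. ennreal (exp (f x)) \<partial>lebesgue) = (\<integral>\<^sup>+x. liminf (\<lambda>n. ?u n x) \<partial>lebesgue)"
    by (simp only: lim)
  also have "\<dots> \<le> liminf (\<lambda>n. integral\<^sup>N lebesgue (?u n))"
  proof (rule nn_integral_liminf)
    fix n
    have "(\<lambda>x. ennreal (exp (clamp (real n) (f x)))) \<in> borel_measurable lebesgue"
      using clamp_m[of "real n"] by measurable
    then show "?u n \<in> borel_measurable lebesgue"
      by (intro borel_measurable_times_ennreal borel_measurable_indicator) auto
  qed
  also have "\<dots> \<le> liminf (\<lambda>n. ennreal (R (M n)))"
  proof (intro Liminf_mono always_eventually allI)
    fix n
    have "(\<lambda>x. exp (clamp (real n) (f x))) integrable_on {a..b}"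
    proof (rule bounded_integrable_on)
      show "(\<lambda>x. exp (clamp (real n) (f x))) \<in> borel_measurable lebesgue"
        using clamp_m[of "real n"] by measurable
      show "\<bar>exp (clamp (real n) (f x))\<bar> \<le> exp n" for x
        using clamp_le(2)[of "real n" "f x"] by simp
    qed
    then show "integral\<^sup>N lebesgue (?u n) \<le> ennreal (R (M n))"
      using le[of n] by (subst nn_integral_eq_integral_interval) (auto intro: ennreal_leI)
  qed
  also have "\<dots> = ennreal (R (integral {a..b} f / (b - a)))"
    by (intro lim_imp_Liminf RM) simp
  finally have "(\<integral>\<^sup>+x\<in>{a..b}. ennreal (exp (f x)) \<partial>lebesgue) / ennreal (b - a)
      \<le> ennreal (R (integral {a..b} f / (b - a))) / ennreal (b - a)"
    by (rule divide_right_mono_ennreal)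
  also have "\<dots> = ennreal (JN_const \<epsilon> * exp (integral {a..b} f / (b - a)))"
    using ab \<epsilon> by (simp add: R_def divide_ennreal JN_const_def)
  finally have "ext_avg I (\<lambda>x. exp (f x)) \<le> enn2ereal (ennreal (JN_const \<epsilon> * exp (integral {a..b} f / (b - a))))"
    unfolding ext_avg_has_endpoints[OF I] by (simp add: less_eq_ennreal.rep_eq)
  moreover have "enn2ereal (ennreal (JN_const \<epsilon> * exp (integral {a..b} f / (b - a))))
      = ereal (JN_const \<epsilon> * exp (integral {a..b} f / (b - a)))"
    using \<epsilon> by (intro enn2ereal_ennreal) (simp add: JN_const_def)
  moreover have "integral {a..b} f / (b - a) = avg I \<phi>"
  proof -
    have "set_integrable lebesgue I f"
      using \<phi>int f\<phi> set_integrable_cong[of lebesgue lebesgue I I f \<phi>] by auto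
    then have "avg I f = integral {a..b} f / (b - a)" by (rule avg_has_endpoints[OF I])
    moreover have "avg I f = avg I \<phi>"
      unfolding avg_def set_lebesgue_integral_def
      by (intro arg_cong2[where f="(/)"] Bochner_Integration.integral_cong) (auto simp: f_def indicator_def)
    ultimately show ?thesis by simp
  qed
  moreover have "ext_avg I (\<lambda>x. exp (f x)) = ext_avg I (\<lambda>x. exp (\<phi> x))"
    unfolding ext_avg_def
    by (intro arg_cong[where f=enn2ereal] arg_cong2[where f="(/)"] nn_integral_cong)
       (auto simp: f\<phi> indicator_def)
  ultimately show "ext_avg I (\<lambda>x. exp (\<phi> x)) \<le> ereal (JN_const \<epsilon> * exp (avg I \<phi>))" by simp
qed

section \<open>Sharpness\<close>

text \<open>For antiderivatives singular at a: differentiability gives continuity to the right of a,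
  and the one-sided limit at a, shifted to 0, is all that remains.\<close>

lemma continuous_on_from_at_right:
  fixes P :: "real \<Rightarrow> real"
  assumes lim: "((\<lambda>s. P (s + a)) \<longlongrightarrow> P a) (at_right 0)" and cont: "\<And>t. a < t \<Longrightarrow> isCont P t"
    and "a \<le> c" "c < d"
  shows "continuous_on {c..d} P"
proof -
  have "continuous_on {a..d} P"
  proof (rule continuous_on_IccI)
    show "(P \<longlongrightarrow> P a) (at_right a)" using lim by (simp add: filterlim_at_right_to_0[of _ _ a])
    show "(P \<longlongrightarrow> P d) (at_left d)" using cont[of d] assms(3,4)
      by (auto simp: isCont_def intro: filterlim_mono at_le)
    show "P \<midarrow>x\<rightarrow> P x" if "a < x" for x using cont[OF that] by (simp add: isCont_def)
  qed (use assms in auto)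
  then show ?thesis using assms by (auto elim: continuous_on_subset)
qed

section \<open>Integrals of the logarithm, its square and its exponential\<close>

lemma ln_scaled_has_derivative:
  fixes a L t :: real
  assumes "0 < L" "a < t"
  shows "((\<lambda>t. ln ((t - a) / L)) has_real_derivative 1 / (t - a)) (at t)"
  using assms by (auto intro!: derivative_eq_intros simp: field_simps)

text \<open>With s = t - a, the antiderivative s ln (s / L) - s tends to 0 at s = 0, which admits c
  = a.\<close>

lemma ln_has_integral:
  fixes a c d L :: real
  assumes L: "0 < L" and cd: "a \<le> c" "c < d"
  shows "((\<lambda>t. ln ((t - a) / L)) has_integral
    ((d - a) * ln ((d - a) / L) - (d - a)) - ((c - a) * ln ((c - a) / L) - (c - a))) {c..d}"
proof (rule fundamental_theorem_of_calculus_interior)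
  let ?P = "\<lambda>t. (t - a) * ln ((t - a) / L) - (t - a)"
  have der: "(?P has_real_derivative ln ((t - a) / L)) (at t)" if "a < t" for t
    using that L by (auto intro!: derivative_eq_intros ln_scaled_has_derivative[OF L that])
  show "continuous_on {c..d} ?P"
  proof (rule continuous_on_from_at_right[OF _ _ cd])
    show "((\<lambda>s. ?P (s + a)) \<longlongrightarrow> ?P a) (at_right 0)" using L by simp real_asymp
  qed (use der DERIV_isCont in blast)
  show "(?P has_vector_derivative ln ((t - a) / L)) (at t)" if "t \<in> {c<..<d}" for t
    using der[of t] that cd by (simp add: has_real_derivative_iff_has_vector_derivative)
qed (use cd in simp)

lemma ln_square_has_integral:
  fixes a c d L :: real
  assumes L: "0 < L" and cd: "a \<le> c" "c < d"
  shows "((\<lambda>t. (ln ((t - a) / L))\<^sup>2) has_integral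
    ((d - a) * (ln ((d - a) / L))\<^sup>2 - 2 * (d - a) * ln ((d - a) / L) + 2 * (d - a))
    - ((c - a) * (ln ((c - a) / L))\<^sup>2 - 2 * (c - a) * ln ((c - a) / L) + 2 * (c - a))) {c..d}"
proof (rule fundamental_theorem_of_calculus_interior)
  let ?P = "\<lambda>t. (t - a) * (ln ((t - a) / L))\<^sup>2 - 2 * (t - a) * ln ((t - a) / L) + 2 * (t - a)"
  have der: "(?P has_real_derivative (ln ((t - a) / L))\<^sup>2) (at t)" if "a < t" for t
  proof -
    have "(2 * t - 2 * a) / (t - a) = 2" using that by (simp add: field_simps)
    then show ?thesis using that L
      by (auto intro!: derivative_eq_intros ln_scaled_has_derivative[OF L that] simp: power2_eq_square)
  qed
  show "continuous_on {c..d} ?P"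
  proof (rule continuous_on_from_at_right[OF _ _ cd])
    show "((\<lambda>s. ?P (s + a)) \<longlongrightarrow> ?P a) (at_right 0)" using L by simp real_asymp
  qed (use der DERIV_isCont in blast)
  show "(?P has_vector_derivative (ln ((t - a) / L))\<^sup>2) (at t)" if "t \<in> {c<..<d}" for t
    using der[of t] that cd by (simp add: has_real_derivative_iff_has_vector_derivative)
qed (use cd in simp)

text \<open>The integrand is a power with exponent -\<epsilon>; \<epsilon> < 1 makes its
  antiderivative vanish continuously at a.\<close>

lemma exp_ln_has_integral:
  fixes a b \<epsilon> :: real
  assumes ab: "a < b" and \<epsilon>: "\<epsilon> < 1"
  shows "((\<lambda>t. exp (- \<epsilon> * ln ((t - a) / (b - a)))) has_integral (b - a) / (1 - \<epsilon>)) {a..b}"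
proof -
  define L where "L = b - a"
  have L: "0 < L" using ab by (simp add: L_def)
  let ?P = "\<lambda>t. L / (1 - \<epsilon>) * ((t - a) / L) powr (1 - \<epsilon>)"
  have der: "(?P has_real_derivative exp (- \<epsilon> * ln ((t - a) / L))) (at t)" if t: "a < t" for t
  proof -
    have "(?P has_real_derivative L / (1 - \<epsilon>) * ((1 - \<epsilon>) * ((t - a) / L) powr (1 - \<epsilon> - 1) * (1 / L))) (at t)"
      using t L by (auto intro!: derivative_eq_intros)
    also have "L / (1 - \<epsilon>) * ((1 - \<epsilon>) * ((t - a) / L) powr (1 - \<epsilon> - 1) * (1 / L)) = exp (- \<epsilon> * ln ((t - a) / L))"
      using t L \<epsilon> by (simp add: powr_def)
    finally show ?thesis .
  qed
  have "((\<lambda>t. exp (- \<epsilon> * ln ((t - a) / L))) has_integral ?P b - ?P a) {a..b}"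
  proof (rule fundamental_theorem_of_calculus_interior)
    show "continuous_on {a..b} ?P"
    proof (rule continuous_on_from_at_right[OF _ _ order_refl ab])
      have "0 < 1 - \<epsilon>" using \<epsilon> by simp
      then show "((\<lambda>s. ?P (s + a)) \<longlongrightarrow> ?P a) (at_right 0)" using L by simp real_asymp
    qed (use der DERIV_isCont in blast)
    show "(?P has_vector_derivative exp (- \<epsilon> * ln ((t - a) / L))) (at t)" if "t \<in> {a<..<b}" for t
      using der[of t] that by (simp add: has_real_derivative_iff_has_vector_derivative)
  qed (use ab in simp)
  then show ?thesis using ab L by (simp add: L_def)
qed

lemma variance_ln_le:
  fixes a c d L :: real
  assumes L: "0 < L" and cd: "a \<le> c" "c < d"
  shows "integral {c..d} (\<lambda>t. (ln ((t - a) / L))\<^sup>2) / (d - c)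
    - (integral {c..d} (\<lambda>t. ln ((t - a) / L)) / (d - c))\<^sup>2 \<le> 1"
proof -
  define x y \<alpha> \<beta> m where "x = c - a" and "y = d - a" and "\<alpha> = ln (x / L)" and "\<beta> = ln (y / L)"
    and "m = d - c"
  have m: "m = y - x" "0 < m" using cd by (auto simp: m_def x_def y_def)
  have xy: "0 \<le> x * y" using cd by (simp add: x_def y_def)
  define A B where "A = integral {c..d} (\<lambda>t. ln ((t - a) / L))"
    and "B = integral {c..d} (\<lambda>t. (ln ((t - a) / L))\<^sup>2)"
  have A: "A = (y * \<beta> - y) - (x * \<alpha> - x)"
    using integral_unique[OF ln_has_integral[OF assms]]
    by (simp add: A_def x_def y_def \<alpha>_def \<beta>_def)
  have B: "B = (y * \<beta>\<^sup>2 - 2 * y * \<beta> + 2 * y) - (x * \<alpha>\<^sup>2 - 2 * x * \<alpha> + 2 * x)"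
    using integral_unique[OF ln_square_has_integral[OF assms]]
    by (simp add: B_def x_def y_def \<alpha>_def \<beta>_def)
  \<comment> \<open>The defect from m^2 is a nonnegative multiple of a square and vanishes for c =
    a, where the variance is exactly 1.\<close>
  have "m * B - A\<^sup>2 = m\<^sup>2 - x * y * (\<beta> - \<alpha>)\<^sup>2"
    unfolding A B m(1) by (simp add: algebra_simps power2_eq_square)
  then have "m * B - A\<^sup>2 \<le> m\<^sup>2" using xy by simp
  moreover have "B / m - (A / m)\<^sup>2 = (m * B - A\<^sup>2) / m\<^sup>2"
    using m(2) by (simp add: power2_eq_square field_simps)
  ultimately have "B / m - (A / m)\<^sup>2 \<le> 1" using m(2) by simp
  then show ?thesis by (simp add: A_def B_def m_def)
qed

text \<open>For t uniform on I, - ln ((t - a) / (b - a)) has the standard exponential distribution,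
  with mean and variance 1 and exponential moment 1 / (1 - \<epsilon>). The slack between \<epsilon>
  and \<epsilon>' lets these functions test larger BMO classes as well.\<close>

lemma log_extremal:
  assumes I: "has_endpoints I a b" and \<epsilon>: "0 \<le> \<epsilon>" "\<epsilon> \<le> \<epsilon>'"
  defines "\<phi> \<equiv> \<lambda>t. - \<epsilon> * ln ((t - a) / (b - a))"
  shows "\<phi> \<in> BMO_eps \<epsilon>' I" "avg I \<phi> = \<epsilon>"
    "\<epsilon> < 1 \<Longrightarrow> ext_avg I (\<lambda>t. exp (\<phi> t)) = ereal (1 / (1 - \<epsilon>))"
proof -
  define L where "L = b - a"
  have ab: "a < b" "0 < L" using I by (auto simp: has_endpoints_def L_def)
  \<comment> \<open>At t = a the value is 0, by the convention ln 0 = 0.\<close>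
  have nonneg: "0 \<le> \<phi> t" if "t \<in> {a..b}" for t
  proof (cases "t = a")
    case False
    then have "ln ((t - a) / (b - a)) \<le> 0" using that ab by (simp add: divide_le_eq_1)
    then show ?thesis using \<epsilon> by (simp add: \<phi>_def mult_nonneg_nonpos)
  qed (simp add: \<phi>_def)
  have int1: "(\<lambda>t. ln ((t - a) / (b - a))) integrable_on {c..d}"
    and int2: "(\<lambda>t. (ln ((t - a) / (b - a)))\<^sup>2) integrable_on {c..d}"
    if "a \<le> c" "c < d" for c d
    using ln_has_integral[OF ab(2) that] ln_square_has_integral[OF ab(2) that] by (auto simp: L_def)
  have \<phi>int: "\<phi> integrable_on {c..d}"
    "integral {c..d} \<phi> = - \<epsilon> * integral {c..d} (\<lambda>t. ln ((t - a) / (b - a)))"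
    if "a \<le> c" "c < d" for c d
    using has_integral_mult_right[OF integrable_integral[OF int1[OF that]], of "- \<epsilon>"]
    unfolding \<phi>_def by (blast, blast intro: integral_unique)
  have \<phi>2: "(\<lambda>t. (\<phi> t)\<^sup>2) = (\<lambda>t. \<epsilon>\<^sup>2 * (ln ((t - a) / (b - a)))\<^sup>2)"
    by (simp add: \<phi>_def power_mult_distrib)
  \<comment> \<open>Nonnegativity upgrades gauge integrability to Lebesgue integrability.\<close>
  have "\<phi> absolutely_integrable_on {a..b}"
    using \<phi>int(1)[of a b] ab nonneg by (intro nonnegative_absolutely_integrable_1) auto
  then have sint: "set_integrable lebesgue J \<phi>" if "has_endpoints J c d" "J \<subseteq> I" for J c d
    by (rule set_integrable_subset)
       (use that I has_endpoints_sets in \<open>auto simp: has_endpoints_def\<close>)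
  have "ext_avg J (\<lambda>x. (\<phi> x)\<^sup>2) - ereal ((avg J \<phi>)\<^sup>2) \<le> ereal (\<epsilon>\<^sup>2)"
    if J: "bounded_interval J" "J \<subseteq> I" for J
  proof -
    obtain c d where e: "has_endpoints J c d" using bounded_interval_endpoints[OF J(1)] by blast
    have "{c<..<d} \<subseteq> {a..b}" using e I J(2) by (auto simp: has_endpoints_def)
    then have cd: "a \<le> c" "c < d"
      using e by (auto simp: has_endpoints_def greaterThanLessThan_subseteq_atLeastAtMost_iff)
    have "avg J \<phi> = - \<epsilon> * (integral {c..d} (\<lambda>t. ln ((t - a) / (b - a))) / (d - c))"
      using avg_has_endpoints[OF e sint[OF e J(2)]] \<phi>int(2)[OF cd] by simp
    moreover have "ext_avg J (\<lambda>x. (\<phi> x)\<^sup>2)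
        = ereal (\<epsilon>\<^sup>2 * (integral {c..d} (\<lambda>t. (ln ((t - a) / (b - a)))\<^sup>2) / (d - c)))"
      using ext_avg_eq_integral[OF e _ zero_le_power2, of \<phi>] int2[OF cd] unfolding \<phi>2
      by (simp add: integrable_on_mult_right)
    moreover have "\<epsilon>\<^sup>2 * (integral {c..d} (\<lambda>t. (ln ((t - a) / (b - a)))\<^sup>2) / (d - c)
        - (integral {c..d} (\<lambda>t. ln ((t - a) / (b - a))) / (d - c))\<^sup>2) \<le> \<epsilon>\<^sup>2 * 1"
      using variance_ln_le[OF ab(2) cd] unfolding L_def by (intro mult_left_mono) auto
    ultimately show ?thesis by (simp add: power_mult_distrib power_divide right_diff_distrib)
  qed
  then have sup: "BMO_sup I \<phi> \<le> ereal (\<epsilon>\<^sup>2)" unfolding BMO_sup_def by (intro SUP_least) auto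
  then have "real_of_ereal (BMO_sup I \<phi>) \<le> \<epsilon>\<^sup>2" by (cases "BMO_sup I \<phi>") auto
  then have "sqrt (real_of_ereal (BMO_sup I \<phi>)) \<le> \<epsilon>" using \<epsilon> by (intro real_le_lsqrt) auto
  moreover have "BMO_sup I \<phi> < \<infinity>" using sup by (cases "BMO_sup I \<phi>") auto
  ultimately show "\<phi> \<in> BMO_eps \<epsilon>' I"
    using sint[OF I] \<epsilon> by (simp add: BMO_eps_def BMO_def BMO_norm_def)
  show "avg I \<phi> = \<epsilon>"
  proof -
    have "integral {a..b} (\<lambda>t. ln ((t - a) / (b - a))) = - (b - a)"
      using integral_unique[OF ln_has_integral[OF ab(2) order_refl ab(1)]] ab by (simp add: L_def)
    then have "integral {a..b} \<phi> = \<epsilon> * (b - a)"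
      using \<phi>int(2)[of a b] ab by (simp del: minus_diff_eq)
    then show ?thesis using avg_has_endpoints[OF I sint[OF I]] ab by simp
  qed
  show "ext_avg I (\<lambda>t. exp (\<phi> t)) = ereal (1 / (1 - \<epsilon>))" if "\<epsilon> < 1"
    using exp_ln_has_integral[OF ab(1) that] ab
    by (subst ext_avg_eq_integral[OF I]) (auto simp: \<phi>_def integral_unique)
qed

text \<open>Testing on the logarithm gives 1 / (1 - \<epsilon>) \<le> C exp \<epsilon>. The case
  \<epsilon>' = 1 serves for the sharpness of the threshold.\<close>

lemma JN_const_le_of_integral_JN:
  assumes "bounded_interval I" and C: "integral_JN I \<epsilon>' C" and \<epsilon>: "0 \<le> \<epsilon>" "\<epsilon> < 1" "\<epsilon> \<le> \<epsilon>'"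
  shows "JN_const \<epsilon> \<le> C"
proof -
  obtain a b where I: "has_endpoints I a b" using bounded_interval_endpoints[OF assms(1)] by blast
  note log = log_extremal[OF I \<epsilon>(1,3)]
  have "ereal (1 / (1 - \<epsilon>)) \<le> ereal (C * exp \<epsilon>)"
    using C[unfolded integral_JN_def, rule_format, OF log(1)] unfolding log(2) log(3)[OF \<epsilon>(2)] .
  then show ?thesis using \<epsilon> by (simp add: JN_const_def exp_minus field_simps)
qed

theorem mainTheorem1:
  fixes I :: "real set"
  assumes "bounded_interval I"
  shows "(\<forall>\<epsilon>. 0 \<le> \<epsilon> \<and> \<epsilon> < 1 \<longrightarrow> integral_JN I \<epsilon> (JN_const \<epsilon>))
    \<and> ((\<forall>\<epsilon>. 0 \<le> \<epsilon> \<and> \<epsilon> < 1 \<longrightarrow> (\<exists>C. integral_JN I \<epsilon> C))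
       \<and> (\<forall>\<epsilon>\<^sub>0::real. (\<forall>\<epsilon>. 0 \<le> \<epsilon> \<and> \<epsilon> < \<epsilon>\<^sub>0 \<longrightarrow> (\<exists>C. integral_JN I \<epsilon> C)) \<longrightarrow> \<epsilon>\<^sub>0 \<le> 1))
    \<and> (\<forall>\<epsilon>. 0 \<le> \<epsilon> \<and> \<epsilon> < 1 \<longrightarrow> (\<forall>C. integral_JN I \<epsilon> C \<longrightarrow> JN_const \<epsilon> \<le> C))"
proof (intro conjI allI impI)
  note JN = integral_JN_JN_const[OF assms]
  show "integral_JN I \<epsilon> (JN_const \<epsilon>)" if "0 \<le> \<epsilon> \<and> \<epsilon> < 1" for \<epsilon>
    using JN that by simp
  show "\<exists>C. integral_JN I \<epsilon> C" if "0 \<le> \<epsilon> \<and> \<epsilon> < 1" for \<epsilon>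
    using JN that by blast
  show "JN_const \<epsilon> \<le> C" if "0 \<le> \<epsilon> \<and> \<epsilon> < 1" "integral_JN I \<epsilon> C" for \<epsilon> C
    using JN_const_le_of_integral_JN[OF assms that(2)] that(1) by simp
  show "\<epsilon>\<^sub>0 \<le> 1" if *: "\<forall>\<epsilon>. 0 \<le> \<epsilon> \<and> \<epsilon> < \<epsilon>\<^sub>0 \<longrightarrow> (\<exists>C. integral_JN I \<epsilon> C)" for \<epsilon>\<^sub>0 :: real
  proof (rule ccontr)
    \<comment> \<open>A threshold above 1 would admit the parameter 1. Its constant C would bound
      \<open>JN_const \<epsilon>\<close> for all 0 \<le> \<epsilon> < 1, but this tends to
      \<infinity> as \<epsilon> increases to 1.\<close>
    assume "\<not> \<epsilon>\<^sub>0 \<le> 1"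
    with * obtain C where C: "integral_JN I 1 C" by force
    have "\<forall>\<^sub>F \<epsilon> in at_left 1. 0 \<le> \<epsilon> \<and> \<epsilon> < (1::real)"
      using eventually_at_left_real[of 0 "1::real"] by (auto elim: eventually_mono)
    then have "\<forall>\<^sub>F \<epsilon> in at_left 1. JN_const \<epsilon> \<le> C"
      by eventually_elim (auto intro: JN_const_le_of_integral_JN[OF assms C])
    moreover have "filterlim JN_const at_top (at_left 1)"
      unfolding JN_const_def by real_asymp
    then have "\<forall>\<^sub>F \<epsilon> in at_left 1. C < JN_const \<epsilon>"
      by (simp add: filterlim_at_top_dense)
    ultimately have "\<forall>\<^sub>F \<epsilon> in at_left (1::real). False"
      by eventually_elim simp
    then show False by simp
  qed
qed

end
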